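(* Let $\mathbb P$ be the law of static positive conductances $a=\{a(x,x+1)\colon x\in\mathbb Z\}$ that are stationary and ergodic with respect to the spatial shifts of $\mathbb Z$ and obey $$\mathbb P\bigl(a(0,1)<\infty\bigr)=1\quad\text{and}\quad\mathbb E\bigl(a(0,1)^{-1}\bigr)=\infty.$$ Then for each $\delta>0$, $$\mathbb E\,P^0_a\bigl(|X_t|\ge\delta\sqrt t\bigr)\underset{t\to\infty}{\longrightarrow}0.$$ In particular, under the diffusive scaling the random walk tends to the identically zero process in the sense of finite-dimensional distributions averaged over the environment: for any $k\ge1$ and $t_1,\dots,t_k\ge0$, the vector $n^{-1/2}(X_{nt_1},\dots,X_{nt_k})$ tends to $0$ in probability under the averaged law $\mathbb E P^0_a(\cdot)$ as $n\to\infty$.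
   Context: $a(x,x+1)=a(x+1,x)$. For a given sample $a$, $X=\{X_t\colon t\ge0\}$ is the (variable speed) continuous-time Markov chain on $\mathbb Z$ with generator $(Lf)(x)=\sum_{z=\pm1}a(x,x+z)[f(x+z)-f(x)]$ (it is non-explosive for $\mathbb P$-a.e. $a$). $P^x_a$ denotes its law with $P^x_a(X_0=x)=1$. $\mathbb E$ is expectation with respect to $\mathbb P$. *)

theory Defs
  imports "HOL-Probability.Probability"
begin

(* In an environment a :: int => ennreal, a x is the conductance a(x,x+1) of the edge {x,x+1}.
   The value infinity is permitted here and excluded almost surely by a hypothesis of the
   theorem. *)

definition env_space :: "(int \<Rightarrow> ennreal) measure" where
  "env_space = (\<Pi>\<^sub>M x\<in>UNIV. borel)"

definition shift :: "int \<Rightarrow> (int \<Rightarrow> ennreal) \<Rightarrow> (int \<Rightarrow> ennreal)" where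
  "shift z a = (\<lambda>x. a (x + z))"

definition stationary :: "(int \<Rightarrow> ennreal) measure \<Rightarrow> bool" where
  "stationary P \<longleftrightarrow> (\<forall>z. distr P env_space (shift z) = P)"

definition ergodic :: "(int \<Rightarrow> ennreal) measure \<Rightarrow> bool" where
  "ergodic P \<longleftrightarrow>
     (\<forall>A\<in>sets env_space. (\<forall>z. shift z -` A = A) \<longrightarrow> measure P A = 0 \<or> measure P A = 1)"

(* Conductance of the unoriented edge joining x and y, meant for neighbours x and y only.
   enn2real sends infinity to 0, which is immaterial because infinite conductances have
   probability zero. *)

definition cond :: "(int \<Rightarrow> ennreal) \<Rightarrow> int \<Rightarrow> int \<Rightarrow> real" where
  "cond a x y = enn2real (a (min x y))"

definition gen :: "(int \<Rightarrow> ennreal) \<Rightarrow> (int \<Rightarrow> real) \<Rightarrow> int \<Rightarrow> real" where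
  "gen a f x = (\<Sum>z\<in>{-1, 1}. cond a x (x + z) * (f (x + z) - f x))"

(* (X t) for t >= 0, under the family (Q x) of laws indexed by the starting point, is a
   time-homogeneous Markov chain on the integers with generator L: it starts at x, its paths are
   right-continuous with left limits, it has the Markov property, and L is the derivative of the
   semigroup at time 0 on finitely supported functions.  The left limits are taken in the
   discrete space of integers, so jump times cannot accumulate: the chain is non-explosive. *)

definition ctmc ::
  "((int \<Rightarrow> real) \<Rightarrow> int \<Rightarrow> real) \<Rightarrow> (int \<Rightarrow> 'w measure) \<Rightarrow> (real \<Rightarrow> 'w \<Rightarrow> int) \<Rightarrow> bool" where
  "ctmc L Q X \<longleftrightarrow>
     (\<forall>x. prob_space (Q x)) \<and>
     (\<forall>x. \<forall>t\<ge>0. X t \<in> Q x \<rightarrow>\<^sub>M count_space UNIV) \<and>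
     (\<forall>x. AE w in Q x. X 0 w = x) \<and>
     (\<forall>x. AE w in Q x.
        (\<forall>t\<ge>0. ((\<lambda>s. X s w) \<longlongrightarrow> X t w) (at_right t)) \<and>
        (\<forall>t>0. \<exists>l. ((\<lambda>s. X s w) \<longlongrightarrow> l) (at_left t))) \<and>
     (\<forall>x (n::nat) (s::nat \<Rightarrow> real) y t z. 0 \<le> s 0 \<and> mono_on {..n} s \<and> 0 \<le> t \<longrightarrow>
        measure (Q x) {w \<in> space (Q x). (\<forall>i\<le>n. X (s i) w = y i) \<and> X (s n + t) w = z} =
        measure (Q x) {w \<in> space (Q x). \<forall>i\<le>n. X (s i) w = y i} *
        measure (Q (y n)) {w \<in> space (Q (y n)). X t w = z}) \<and>
     (\<forall>f x. finite {y. f y \<noteq> 0} \<longrightarrow>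
        ((\<lambda>t. \<integral>w. f (X t w) \<partial>Q x) has_real_derivative L f x) (at 0 within {0..}))"

(* The averaged probability E P^0_a(A), with Q a x in the role of P^x_a.  It is an nn_integral, so
   that it does not depend on the choice of Q a off a set of environments that is P-null;
   for almost every a the finite-dimensional laws under Q a 0 are determined by a. *)

definition averaged_prob ::
  "(int \<Rightarrow> ennreal) measure \<Rightarrow> ((int \<Rightarrow> ennreal) \<Rightarrow> int \<Rightarrow> 'w measure) \<Rightarrow> ('w \<Rightarrow> bool) \<Rightarrow> ennreal"
  where
  "averaged_prob P Q A = (\<integral>\<^sup>+a. emeasure (Q a 0) {w \<in> space (Q a 0). A w} \<partial>P)"

end

theory Submission
  imports Defs
begin

text \<open>
  Write \<open>r(x) = 1 / a(x, x+1)\<close> for the resistance of an edge. Cutting it off from above gives a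
  bounded function \<open>g\<close> of the environment whose mean \<open>m\<close> is as large as we please, because
  \<open>\<E> r = \<infinity>\<close>. Let \<open>\<psi>\<close> be the potential on the integers with \<open>\<psi>(0) = 0\<close> and increments
  \<open>\<psi>(x+1) - \<psi>(x) = g\<close> at the edge \<open>{x, x+1}\<close>. Two facts about \<open>\<psi>\<close> compete.

  First, the chain is reversible with respect to counting measure and the environment is stationary,
  so the averaged second moment of \<open>\<psi>(X\<^sub>t)\<close> is at most \<open>2 t\<close> times the energy per edge,
  \<open>\<E> (a g\<^sup>2) \<le> \<E> g = m\<close>: the cut-off resistance satisfies \<open>a g \<le> 1\<close>. Secondly, by the ergodic
  theorem \<open>\<bar>\<psi>(x)\<bar> \<ge> m \<bar>x\<bar> / 2\<close> with high probability when \<open>\<bar>x\<bar>\<close> is large, and \<open>\<psi>\<close> is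
  monotone. On the event \<open>\<bar>X\<^sub>t\<bar> \<ge> \<delta> \<surd>t\<close> therefore typically \<open>\<psi>(X\<^sub>t)\<^sup>2 \<ge> m\<^sup>2 \<delta>\<^sup>2 t / 4\<close>, and
  Chebyshev's inequality bounds its averaged probability by \<open>8 / (\<delta>\<^sup>2 m)\<close> up to an error that
  vanishes as \<open>t \<rightarrow> \<infinity>\<close>. Since \<open>m\<close> is arbitrary, the limit is zero.

  The chain is only given through its Markov property and its generator on finitely supported
  functions, for almost every environment separately, so neither reversibility nor measurable
  dependence on the environment is available directly. Both come from an explicit approximation:
  the discrete-time walk with time step \<open>h = t / n\<close> and conductances \<open>min a (n / (4 t))\<close>, that is,
  the \<open>n\<close>-th power of \<open>K = I + h L\<close> with truncated rates. This \<open>K\<close> is positive, symmetric and lazy,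
  and it depends measurably and covariantly on the environment. On a finite box the truncation
  disappears for large \<open>n\<close>, and the chain killed on leaving the box is close to the walk killed
  there; the mass lost by killing is small because the function \<open>w\<close> with
  \<open>a(x, x+1) (w(x+1) - w(x)) = 2 x + 1\<close> satisfies \<open>L w = 2\<close> and tends to infinity in both
  directions. Hence for almost every environment the tail of \<open>X\<^sub>t\<close> is at most the lower limit of
  the tails of the walks (\<open>semigroup_le_walk\<close>, \<open>tail_le_liminf\<close>), and Fatou's lemma reduces the
  theorem to a bound for the walks that is uniform in \<open>n\<close> (\<open>expectation_walk_tail\<close>).

  For the walks the energy estimate (\<open>expectation_msq_le\<close>) is a computation with functions of the
  environment. The one place where a sign matters is the correlation between the drift of \<open>\<psi>\<close> at
  the starting point and the later displacement; it enters with a minus sign and is nonnegative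
  because a lazy symmetric operator is positive semidefinite.
\<close>

section \<open>Suprema of Birkhoff sums\<close>

text \<open>
  The part of Birkhoff's theorem that the lower bound on the potential rests on. Let \<open>F n\<close> be the
  largest of the first \<open>n\<close> partial sums, including the empty one. Then
  \<open>F (n+1) - F n \<circ> T = max (- F n \<circ> T) f\<close> has nonnegative mean since \<open>T\<close> preserves the measure
  and \<open>F\<close> increases in \<open>n\<close>. Where \<open>F\<close> is unbounded this difference is eventually \<open>f\<close>; if that
  happened almost surely, \<open>f\<close> would have nonnegative mean. The set where \<open>F\<close> is unbounded is
  invariant, so by ergodicity it is null.
\<close>

lemma (in prob_space) birkhoff_sums_bounded_above:
  fixes f :: "'a \<Rightarrow> real"
  assumes T[measurable]: "T \<in> measurable M M" and T_inv: "distr M M T = M"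
    and erg: "\<And>A. A \<in> sets M \<Longrightarrow> T -` A \<inter> space M = A \<Longrightarrow> prob A = 0 \<or> prob A = 1"
    and f[measurable]: "f \<in> borel_measurable M" and bound: "\<And>x. \<bar>f x\<bar> \<le> C"
    and neg: "expectation f < 0"
  shows "AE x in M. \<exists>B. \<forall>n. (\<Sum>i<n. f ((T ^^ i) x)) \<le> B"
proof -
  define F where "F = rec_nat (\<lambda>x. 0::real) (\<lambda>_ G x. max 0 (f x + G (T x)))"
  have F0: "F 0 x = 0" and FS: "F (Suc n) x = max 0 (f x + F n (T x))" for n x
    by (simp_all add: F_def)
  have Fm[measurable]: "F n \<in> borel_measurable M" for n
  proof (induction n)
    case 0 show ?case by (simp add: F0[abs_def])
  next
    case (Suc n)
    note [measurable] = Suc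
    show ?case by (simp add: FS[abs_def])
  qed
  have Fnn: "0 \<le> F n x" for n x by (cases n) (simp_all add: F0 FS)
  have Fmono: "F n x \<le> F (Suc n) x" for n x
  proof (induction n arbitrary: x)
    case 0 show ?case by (simp add: F0 Fnn)
  next
    case (Suc n) show ?case using Suc[of "T x"] by (simp add: FS[of "Suc n"] FS[of n])
  qed
  have Finc: "m \<le> n \<Longrightarrow> F m x \<le> F n x" for m n x
    by (rule lift_Suc_mono_le[where f="\<lambda>n. F n x"]) (auto simp: Fmono)
  have Fle: "F n x \<le> real n * C" for n x
  proof (induction n arbitrary: x)
    case 0 show ?case by (simp add: F0)
  next
    case (Suc n)
    have "C \<ge> 0" using bound[of x] by linarith
    then show ?case using Suc[of "T x"] bound[of x] by (auto simp: FS algebra_simps)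
  qed
  have SF: "(\<Sum>i<n. f ((T ^^ i) x)) \<le> F n x" for n x
  proof (induction n arbitrary: x)
    case 0 show ?case by (simp add: F0)
  next
    case (Suc n)
    have "(\<Sum>i<Suc n. f ((T ^^ i) x)) = f x + (\<Sum>i<n. f ((T ^^ i) (T x)))"
      by (simp only: sum.lessThan_Suc_shift funpow_Suc_right) simp
    then show ?case using Suc[of "T x"] by (simp add: FS)
  qed
  define A where "A = {x \<in> space M. \<forall>B::nat. \<exists>n. real B < F n x}"
  have A[measurable]: "A \<in> sets M" unfolding A_def by measurable
  have Tsp: "x \<in> space M \<Longrightarrow> T x \<in> space M" for x using T by (rule measurable_space)
  have A_inv: "T -` A \<inter> space M = A"
  proof (intro set_eqI iffI)
    fix x assume "x \<in> T -` A \<inter> space M"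
    then have x: "x \<in> space M" and *: "\<And>B::nat. \<exists>n. real B < F n (T x)" by (auto simp: A_def)
    have "\<exists>n. real B < F n x" for B :: nat
    proof -
      obtain n where "real (B + nat \<lceil>C\<rceil>) < F n (T x)" using * by blast
      then have "real B < F (Suc n) x" using bound[of x] unfolding FS by linarith
      then show ?thesis by blast
    qed
    then show "x \<in> A" using x by (simp add: A_def)
  next
    fix x assume "x \<in> A"
    then have x: "x \<in> space M" and *: "\<And>B::nat. \<exists>n. real B < F n x" by (auto simp: A_def)
    have "\<exists>n. real B < F n (T x)" for B :: nat
    proof -
      obtain n where n: "real (B + nat \<lceil>C\<rceil>) < F n x" using * by blast
      then obtain k where k: "n = Suc k" by (cases n) (auto simp: F0)
      have "real B < F k (T x)" using n bound[of x] Fnn[of k "T x"] unfolding k FS by linarith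
      then show ?thesis by blast
    qed
    then show "x \<in> T -` A \<inter> space M" using x Tsp by (simp add: A_def)
  qed
  have int: "integrable M (F n)" for n
    by (rule integrable_const_bound[where B="real n * C"]) (use Fnn Fle in \<open>auto intro!: AE_I2\<close>)
  have intT: "integrable M (\<lambda>x. F n (T x))" for n
    by (rule integrable_const_bound[where B="real n * C"]) (use Fnn Fle in \<open>auto intro!: AE_I2\<close>)
  have ET: "expectation (\<lambda>x. F n (T x)) = expectation (F n)" for n
    using integral_distr[of T M M "F n"] T_inv by simp
  have "prob A \<noteq> 1"
  proof
    assume "prob A = 1"
    then have ae: "AE x in M. x \<in> A" using prob_eq_1[OF A] by simp
    define G where "G = (\<lambda>n x. F (Suc n) x - F n (T x))"
    have G: "G n x = max (- F n (T x)) (f x)" for n x unfolding G_def FS by linarith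
    have "(\<lambda>n. expectation (G n)) \<longlonglongrightarrow> expectation f"
    proof (rule integral_dominated_convergence[where w="\<lambda>_. C"])
      show "AE x in M. (\<lambda>n. G n x) \<longlonglongrightarrow> f x"
        using ae AE_space
      proof eventually_elim
        case (elim x)
        then have "T x \<in> A" using A_inv by blast
        then obtain n where n: "real (nat \<lceil>C\<rceil>) < F n (T x)" unfolding A_def by blast
        have "G k x = f x" if "k \<ge> n" for k
          using Finc[OF that, of "T x"] n bound[of x] unfolding G by linarith
        then show ?case by (intro tendsto_eventually) (auto simp: eventually_sequentially)
      qed
      show "AE x in M. norm (G n x) \<le> C" for n
        using bound Fnn by (intro AE_I2) (simp add: G max_def abs_le_iff, smt (verit))
    qed (auto simp: G_def)
    moreover have "0 \<le> expectation (G n)" for n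
      unfolding G_def using int intT ET Fmono by (simp add: integral_mono)
    ultimately have "0 \<le> expectation f" by (intro LIMSEQ_le_const) auto
    then show False using neg by simp
  qed
  then have "prob A = 0" using erg[OF A A_inv] by blast
  then have "AE x in M. x \<notin> A" using A prob_eq_0 by simp
  then show ?thesis using AE_space
  proof eventually_elim
    case (elim x)
    then have "\<exists>B::nat. \<forall>n. F n x \<le> real B" unfolding A_def by (auto simp: not_less)
    then obtain B :: nat where "\<And>n. F n x \<le> real B" by blast
    then show ?case using SF order_trans by blast
  qed
qed

section \<open>Discrete-time walks on the integers and potentials\<close>

text \<open>
  The transition operator \<open>I + h L\<close> of a discrete-time walk, where \<open>\<beta> x\<close> is the conductance of the
  edge between \<open>x\<close> and \<open>x + 1\<close>.
\<close>

definition walk_step :: "real \<Rightarrow> (int \<Rightarrow> real) \<Rightarrow> (int \<Rightarrow> real) \<Rightarrow> int \<Rightarrow> real" where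
  "walk_step h \<beta> f x = f x + h * (\<beta> x * (f (x + 1) - f x) + \<beta> (x - 1) * (f (x - 1) - f x))"

definition potential :: "(int \<Rightarrow> real) \<Rightarrow> int \<Rightarrow> real" where
  "potential \<gamma> x = sum \<gamma> {0..<x} - sum \<gamma> {x..<0}"

lemma potential_0 [simp]: "potential \<gamma> 0 = 0"
  by (simp add: potential_def)

lemma potential_step: "potential \<gamma> (x + 1) = potential \<gamma> x + \<gamma> x"
proof (cases "x \<ge> 0")
  case True
  then have "{0..<x + 1} = insert x {0..<x}" by auto
  with True show ?thesis by (simp add: potential_def)
next
  case False
  then have "{x..<0} = insert x {x + 1..<0}" by auto
  with False show ?thesis by (simp add: potential_def)
qed

lemma walk_step_convex:
  "walk_step h \<beta> f x = (1 - h * (\<beta> x + \<beta> (x - 1))) * f x + h * \<beta> x * f (x + 1) + h * \<beta> (x - 1) * f (x - 1)"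
  by (simp add: walk_step_def algebra_simps)

lemma walk_step_const [simp]: "walk_step h \<beta> (\<lambda>_. k) = (\<lambda>_. k)"
  by (simp add: walk_step_def[abs_def])

lemma walk_step_affine:
  "walk_step h \<beta> (\<lambda>y. k * f y + l) x = k * walk_step h \<beta> f x + l"
  by (simp add: walk_step_def algebra_simps)

lemma walk_step_mono:
  assumes "0 \<le> h" "0 \<le> \<beta> x" "0 \<le> \<beta> (x - 1)" "h * (\<beta> x + \<beta> (x - 1)) \<le> 1"
    and "\<And>y. f y \<le> g y"
  shows "walk_step h \<beta> f x \<le> walk_step h \<beta> g x"
  unfolding walk_step_convex using assms by (intro add_mono mult_left_mono) auto

lemma walk_step_abs_le_1:
  assumes "0 \<le> h" "0 \<le> \<beta> x" "0 \<le> \<beta> (x - 1)" "h * (\<beta> x + \<beta> (x - 1)) \<le> 1"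
    and "\<And>y. \<bar>f y\<bar> \<le> 1"
  shows "\<bar>walk_step h \<beta> f x\<bar> \<le> 1"
proof -
  have "walk_step h \<beta> f x \<le> walk_step h \<beta> (\<lambda>_. 1) x"
    using assms by (intro walk_step_mono) (auto simp: abs_le_iff)
  moreover have "walk_step h \<beta> (\<lambda>_. -1) x \<le> walk_step h \<beta> f x"
    using assms by (intro walk_step_mono) (auto simp: abs_le_iff minus_le_iff)
  ultimately show ?thesis by (simp add: abs_le_iff)
qed

lemma walk_step_sum:
  assumes "finite B"
  shows "walk_step h \<beta> (\<lambda>y. if y \<in> B then f y else 0) x
    = (\<Sum>y\<in>B. walk_step h \<beta> (indicator {y}) x * f y)"
proof -
  have "(if z \<in> B then f z else 0) = (\<Sum>y\<in>B. indicator {y} z * f y)" for z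
    using assms by (simp add: indicator_def if_distrib[of "\<lambda>u. u * _"] sum.delta' cong: if_cong)
  then show ?thesis
    by (simp add: walk_step_def sum_distrib_left sum.distrib[symmetric] sum_subtractf[symmetric] algebra_simps)
qed

locale lazy_walk =
  fixes h :: real and \<beta> :: "int \<Rightarrow> real"
  assumes h0: "0 \<le> h" and \<beta>0: "0 \<le> \<beta> x" and lz: "h * (\<beta> x + \<beta> (x - 1)) \<le> 1"
begin

lemma funpow_mono: "(\<And>y. f y \<le> g y) \<Longrightarrow> (walk_step h \<beta> ^^ n) f x \<le> (walk_step h \<beta> ^^ n) g x"
proof (induction n arbitrary: x)
  case (Suc n) then show ?case
    unfolding funpow.simps o_apply by (intro walk_step_mono h0 \<beta>0 lz) auto
qed simp

lemma funpow_affine: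
  "(walk_step h \<beta> ^^ n) (\<lambda>y. k * f y + l) x = k * (walk_step h \<beta> ^^ n) f x + l"
proof (induction n arbitrary: x)
  case (Suc n) then show ?case
    by (simp add: walk_step_affine[symmetric] Suc.IH[abs_def])
qed simp

end

lemma potential_mono:
  assumes "\<And>x. 0 \<le> \<gamma> x" "x \<le> y"
  shows "potential \<gamma> x \<le> potential \<gamma> y"
proof -
  have "potential \<gamma> x \<le> potential \<gamma> (x + int k)" for k
  proof (induction k)
    case (Suc k)
    have "x + int (Suc k) = (x + int k) + 1" by simp
    then show ?case using Suc assms(1)[of "x + int k"] by (simp only: potential_step)
  qed simp
  from this[of "nat (y - x)"] assms(2) show ?thesis by simp
qed

lemma potential_of_nat: "potential \<gamma> (int n) = (\<Sum>i<n. \<gamma> (int i))"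
proof (induction n)
  case (Suc n)
  have "int (Suc n) = int n + 1" by simp
  then show ?case using Suc by (simp only: potential_step sum.lessThan_Suc)
qed simp

lemma potential_of_neg_nat: "potential \<gamma> (- int n) = - (\<Sum>i<n. \<gamma> (- int i - 1))"
proof (induction n)
  case (Suc n)
  have "potential \<gamma> (- int n) = potential \<gamma> (- int n - 1) + \<gamma> (- int n - 1)"
    using potential_step[of \<gamma> "- int n - 1"] by simp
  moreover have "- int (Suc n) = - int n - 1" by simp
  ultimately show ?case using Suc by (simp only: sum.lessThan_Suc)
qed simp

lemma filterlim_int_at_top_bot:
  fixes \<psi> :: "int \<Rightarrow> real"
  assumes m: "0 < m" and growth: "\<forall>\<^sub>F n in sequentially. real n * m \<le> \<psi> (int n) \<and> \<psi> (- int n) \<le> - (real n * m)"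
  shows "filterlim \<psi> at_top at_top" "filterlim \<psi> at_bot at_bot"
proof -
  obtain N where N: "\<And>n. N \<le> n \<Longrightarrow> real n * m \<le> \<psi> (int n) \<and> \<psi> (- int n) \<le> - (real n * m)"
    using growth by (auto simp: eventually_sequentially)
  have large: "Z \<le> \<psi> (int n) \<and> \<psi> (- int n) \<le> - Z" if "max (int N) \<lceil>Z / m\<rceil> \<le> int n" for n Z
  proof -
    from that have "Z / m \<le> real n" by linarith
    then have "Z \<le> real n * m" using m by (simp add: pos_divide_le_eq)
    moreover have "N \<le> n" using that by simp
    ultimately show ?thesis using N[of n] by linarith
  qed
  show "filterlim \<psi> at_top at_top"
    unfolding filterlim_at_top eventually_at_top_linorder
  proof (intro allI exI impI)
    fix Z x assume "max (int N) \<lceil>Z / m\<rceil> \<le> x"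
    then show "Z \<le> \<psi> x" using large[of Z "nat x"] by simp
  qed
  show "filterlim \<psi> at_bot at_bot"
    unfolding filterlim_at_bot eventually_at_bot_linorder
  proof (intro allI exI impI)
    fix Z x assume x: "x \<le> - max (int N) \<lceil>- Z / m\<rceil>"
    then have "x \<le> 0" "max (int N) \<lceil>- Z / m\<rceil> \<le> - x" by linarith+
    then show "\<psi> x \<le> Z" using large[of "- Z" "nat (- x)"] by simp
  qed
qed

lemma potential_comparison:
  assumes "\<And>x. \<gamma> x \<le> \<gamma>' x"
  shows "potential \<gamma> (int n) \<le> potential \<gamma>' (int n)" "potential \<gamma>' (- int n) \<le> potential \<gamma> (- int n)"
  using assms by (auto simp: potential_of_nat potential_of_neg_nat intro!: sum_mono)

section \<open>The energy estimate in a stationary environment\<close>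

lemma shift_shift: "shift x (shift y a) = shift (x + y) a"
  by (simp add: shift_def add.assoc)

lemma shift_0 [simp]: "shift 0 a = a"
  by (simp add: shift_def)

locale stationary_environment = prob_space P
  for P :: "(int \<Rightarrow> ennreal) measure" +
  assumes sets_P [measurable_cong]: "sets P = sets env_space"
    and stationary: "stationary P"
begin

lemma space_P [simp]: "space P = UNIV"
  using sets_eq_imp_space_eq[OF sets_P] by (simp add: env_space_def space_PiM)

lemma shift_measurable [measurable]: "shift z \<in> measurable P P"
proof -
  have "(\<lambda>a x. a (x + z)) \<in> measurable env_space env_space"
    unfolding env_space_def by (rule measurable_PiM_single') auto
  then show ?thesis
    unfolding measurable_cong_sets[OF sets_P sets_P] by (simp add: shift_def[abs_def])
qed

lemma coordinate_measurable [measurable]: "(\<lambda>a. a x) \<in> borel_measurable P"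
  unfolding measurable_cong_sets[OF sets_P refl] env_space_def
  by (rule measurable_component_singleton) simp

lemma distr_shift: "distr P P (shift z) = P"
  using stationary distr_cong[OF refl sets_P, of P "shift z" "shift z"]
  by (simp add: stationary_def)

lemma integral_shift:
  fixes f :: "_ \<Rightarrow> real"
  assumes [measurable]: "f \<in> borel_measurable P"
  shows "(\<integral>a. f (shift z a) \<partial>P) = (\<integral>a. f a \<partial>P)"
  using integral_distr[of "shift z" P P f] distr_shift by simp

lemma AE_shift:
  assumes "AE a in P. R a"
  shows "AE a in P. R (shift z a)"
proof (rule AE_distrD[where M'=P])
  show "shift z \<in> measurable P P" by (rule shift_measurable)
  show "AE a in distr P P (shift z). R a" using assms by (simp only: distr_shift)
qed

text \<open>
  The energy estimate only integrates polynomial expressions in bounded functions of the environment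
  and their shifts; a predicate closed under these operations disposes of all integrability
  conditions.
\<close>

definition bounded_rv :: "((int \<Rightarrow> ennreal) \<Rightarrow> real) \<Rightarrow> bool" where
  "bounded_rv \<zeta> \<longleftrightarrow> \<zeta> \<in> borel_measurable P \<and> (\<exists>C. \<forall>a. \<bar>\<zeta> a\<bar> \<le> C)"

lemma bounded_rvI: "\<zeta> \<in> borel_measurable P \<Longrightarrow> (\<And>a. \<bar>\<zeta> a\<bar> \<le> C) \<Longrightarrow> bounded_rv \<zeta>"
  by (auto simp: bounded_rv_def)

lemma bounded_rv_measurable: "bounded_rv \<zeta> \<Longrightarrow> \<zeta> \<in> borel_measurable P"
  by (simp add: bounded_rv_def)

lemma bounded_rv_integrable: "bounded_rv \<zeta> \<Longrightarrow> integrable P \<zeta>"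
  unfolding bounded_rv_def
  by (elim conjE exE, rule integrable_const_bound) auto

lemma bounded_rv_const [intro, simp]: "bounded_rv (\<lambda>_. k)"
  by (auto simp: bounded_rv_def)

lemma bounded_rv_add [intro]:
  assumes "bounded_rv \<zeta>" "bounded_rv \<xi>" shows "bounded_rv (\<lambda>a. \<zeta> a + \<xi> a)"
proof -
  obtain C D where "\<And>a. \<bar>\<zeta> a\<bar> \<le> C" "\<And>a. \<bar>\<xi> a\<bar> \<le> D" using assms by (auto simp: bounded_rv_def)
  then have "\<bar>\<zeta> a + \<xi> a\<bar> \<le> C + D" for a by (meson abs_triangle_ineq add_mono order_trans)
  with assms show ?thesis
    by (auto simp: bounded_rv_def)
qed

lemma bounded_rv_mult [intro]:
  assumes "bounded_rv \<zeta>" "bounded_rv \<xi>" shows "bounded_rv (\<lambda>a. \<zeta> a * \<xi> a)"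
proof -
  obtain C D where "\<And>a. \<bar>\<zeta> a\<bar> \<le> C" "\<And>a. \<bar>\<xi> a\<bar> \<le> D" using assms by (auto simp: bounded_rv_def)
  then have "\<bar>\<zeta> a * \<xi> a\<bar> \<le> C * D" for a
    unfolding abs_mult by (intro mult_mono) (auto intro: order_trans[OF abs_ge_zero])
  with assms show ?thesis
    by (auto simp: bounded_rv_def)
qed

lemma bounded_rv_diff [intro]:
  assumes "bounded_rv \<zeta>" "bounded_rv \<xi>" shows "bounded_rv (\<lambda>a. \<zeta> a - \<xi> a)"
  using bounded_rv_add[OF assms(1) bounded_rv_mult[OF bounded_rv_const[of "-1"] assms(2)]] by simp

lemma bounded_rv_power [intro]: "bounded_rv \<zeta> \<Longrightarrow> bounded_rv (\<lambda>a. \<zeta> a ^ n)"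
  by (induction n) auto

lemma bounded_rv_shift [intro]:
  assumes "bounded_rv \<zeta>" shows "bounded_rv (\<lambda>a. \<zeta> (shift z a))"
proof -
  from assms have [measurable]: "\<zeta> \<in> borel_measurable P" by (rule bounded_rv_measurable)
  have "(\<lambda>a. \<zeta> (shift z a)) \<in> borel_measurable P" by measurable
  with assms show ?thesis by (auto simp: bounded_rv_def)
qed

end

text \<open>
  The condition \<open>4 h c \<le> 1\<close> is twice as strong as positivity of the transition probabilities: it
  keeps the walk at its place with probability at least one half, and this makes the transition
  operator positive semidefinite.
\<close>

locale stationary_walk = stationary_environment P
  for P :: "(int \<Rightarrow> ennreal) measure" +
  fixes b :: "(int \<Rightarrow> ennreal) \<Rightarrow> real" and c h :: real
  assumes b_measurable: "b \<in> borel_measurable P"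
    and b_nonneg: "0 \<le> b a" and b_le: "b a \<le> c"
    and h_nonneg: "0 \<le> h" and lazy: "4 * (h * c) \<le> 1"
begin

lemma bounded_b [intro, simp]: "bounded_rv b"
  using b_measurable b_nonneg b_le by (auto intro!: bounded_rvI[where C=c])

text \<open>
  The walk as seen from its current position: the environment process, whose transition operator
  acts on functions of the environment.
\<close>

definition step :: "((int \<Rightarrow> ennreal) \<Rightarrow> real) \<Rightarrow> (int \<Rightarrow> ennreal) \<Rightarrow> real" where
  "step \<zeta> a = \<zeta> a + h * (b a * (\<zeta> (shift 1 a) - \<zeta> a)
     + b (shift (-1) a) * (\<zeta> (shift (-1) a) - \<zeta> a))"

lemma bounded_step [intro]: "bounded_rv \<zeta> \<Longrightarrow> bounded_rv (step \<zeta>)"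
  unfolding step_def[abs_def] by (intro bounded_rv_add bounded_rv_mult bounded_rv_diff) auto

lemma bounded_step_funpow [intro]: "bounded_rv \<zeta> \<Longrightarrow> bounded_rv ((step ^^ n) \<zeta>)"
  by (induction n) auto

text \<open>
  Summation by parts. The jumps to the left are turned into jumps to the right by shifting the
  environment one step, under which \<open>P\<close> is invariant. The result is symmetric in the two
  functions, which is the reversibility of the environment process.
\<close>

lemma step_form:
  assumes "bounded_rv \<zeta>" "bounded_rv \<xi>"
  shows "(\<integral>a. \<zeta> a * step \<xi> a \<partial>P) = (\<integral>a. \<zeta> a * \<xi> a \<partial>P)
    - h * (\<integral>a. b a * ((\<zeta> (shift 1 a) - \<zeta> a) * (\<xi> (shift 1 a) - \<xi> a)) \<partial>P)"
proof -
  define A where "A = (\<lambda>a. \<zeta> a * \<xi> a)"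
  define B where "B = (\<lambda>a. b a * (\<zeta> a * (\<xi> (shift 1 a) - \<xi> a)))"
  define B' where "B' = (\<lambda>a. b a * (\<zeta> (shift 1 a) * (\<xi> a - \<xi> (shift 1 a))))"
  have bd: "bounded_rv A" "bounded_rv B" "bounded_rv B'"
    unfolding A_def B_def B'_def using assms by (auto intro!: bounded_rv_mult bounded_rv_diff)
  have e1: "\<zeta> a * step \<xi> a = A a + h * (B a + B' (shift (-1) a))" for a
    by (simp add: step_def A_def B_def B'_def shift_shift algebra_simps)
  have e2: "b a * ((\<zeta> (shift 1 a) - \<zeta> a) * (\<xi> (shift 1 a) - \<xi> a)) = - (B a + B' a)" for a
    by (simp add: B_def B'_def algebra_simps)
  have "(\<integral>a. \<zeta> a * step \<xi> a \<partial>P)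
      = (\<integral>a. A a \<partial>P) + h * ((\<integral>a. B a \<partial>P) + (\<integral>a. B' (shift (-1) a) \<partial>P))"
    unfolding e1 using bd
    by (simp add: bounded_rv_integrable bounded_rv_shift bounded_rv_add)
  also have "(\<integral>a. B' (shift (-1) a) \<partial>P) = (\<integral>a. B' a \<partial>P)"
    by (rule integral_shift[OF bounded_rv_measurable[OF bd(3)]])
  finally show ?thesis
    unfolding e2 using bd by (simp add: bounded_rv_integrable A_def algebra_simps)
qed

lemma step_symmetric:
  assumes "bounded_rv \<zeta>" "bounded_rv \<xi>"
  shows "(\<integral>a. \<zeta> a * step \<xi> a \<partial>P) = (\<integral>a. step \<zeta> a * \<xi> a \<partial>P)"
  using step_form[OF assms] step_form[OF assms(2,1)] by (simp add: mult.commute)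

lemma expectation_step: "bounded_rv \<xi> \<Longrightarrow> (\<integral>a. step \<xi> a \<partial>P) = (\<integral>a. \<xi> a \<partial>P)"
  using step_form[of "\<lambda>_. 1" \<xi>] by simp

text \<open>
  The Dirichlet form is at most \<open>4 c\<close> times the second moment, so laziness lets the identity part
  dominate.
\<close>

lemma step_nonneg_form:
  assumes "bounded_rv \<zeta>"
  shows "0 \<le> (\<integral>a. \<zeta> a * step \<zeta> a \<partial>P)"
proof -
  let ?S = "\<integral>a. (\<zeta> a)\<^sup>2 \<partial>P"
  have sq: "bounded_rv (\<lambda>a. (\<zeta> a)\<^sup>2)" using assms by auto
  have "(\<integral>a. b a * ((\<zeta> (shift 1 a) - \<zeta> a) * (\<zeta> (shift 1 a) - \<zeta> a)) \<partial>P)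
      \<le> (\<integral>a. 2 * c * (\<zeta> (shift 1 a))\<^sup>2 + 2 * c * (\<zeta> a)\<^sup>2 \<partial>P)"
  proof (rule integral_mono)
    fix a
    have "(\<zeta> (shift 1 a) - \<zeta> a) * (\<zeta> (shift 1 a) - \<zeta> a) \<le> 2 * (\<zeta> (shift 1 a))\<^sup>2 + 2 * (\<zeta> a)\<^sup>2"
      using zero_le_power2[of "\<zeta> (shift 1 a) + \<zeta> a"] by (simp add: power2_eq_square algebra_simps)
    then have "b a * ((\<zeta> (shift 1 a) - \<zeta> a) * (\<zeta> (shift 1 a) - \<zeta> a))
        \<le> c * (2 * (\<zeta> (shift 1 a))\<^sup>2 + 2 * (\<zeta> a)\<^sup>2)"
      using b_nonneg[of a] b_le[of a] by (intro mult_mono) auto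
    then show "b a * ((\<zeta> (shift 1 a) - \<zeta> a) * (\<zeta> (shift 1 a) - \<zeta> a))
        \<le> 2 * c * (\<zeta> (shift 1 a))\<^sup>2 + 2 * c * (\<zeta> a)\<^sup>2"
      by (simp add: algebra_simps)
  qed (rule bounded_rv_integrable; use assms in \<open>auto intro!: bounded_rv_mult bounded_rv_diff bounded_rv_add\<close>)+
  also have "\<dots> = 2 * c * (\<integral>a. (\<zeta> (shift 1 a))\<^sup>2 \<partial>P) + 2 * c * ?S"
    using sq by (simp add: bounded_rv_integrable bounded_rv_shift[of "\<lambda>a. (\<zeta> a)\<^sup>2"])
  also have "(\<integral>a. (\<zeta> (shift 1 a))\<^sup>2 \<partial>P) = ?S"
    by (rule integral_shift[OF bounded_rv_measurable[OF sq]])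
  finally have "h * (\<integral>a. b a * ((\<zeta> (shift 1 a) - \<zeta> a) * (\<zeta> (shift 1 a) - \<zeta> a)) \<partial>P)
      \<le> h * (4 * c * ?S)"
    using h_nonneg by (intro mult_left_mono) auto
  also have "\<dots> \<le> ?S"
    using mult_right_mono[OF lazy, of ?S] by (simp add: algebra_simps)
  finally show ?thesis
    using step_form[OF assms assms] by (simp add: power2_eq_square)
qed

text \<open>
  By symmetry half of the steps can be moved to the other factor, which leaves a square or, for an odd
  power, the quadratic form of a single step.
\<close>

lemma step_funpow_nonneg_form:
  assumes "bounded_rv \<zeta>"
  shows "0 \<le> (\<integral>a. \<zeta> a * (step ^^ n) \<zeta> a \<partial>P)"
  using assms
proof (induction n arbitrary: \<zeta> rule: induct_nat_012)
  case 0 show ?case by simp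
next
  case 1 then show ?case using step_nonneg_form by simp
next
  case (ge2 n)
  have "(step ^^ Suc (Suc n)) \<zeta> = step ((step ^^ n) (step \<zeta>))"
    by (simp add: funpow_swap1)
  then have "(\<integral>a. \<zeta> a * (step ^^ Suc (Suc n)) \<zeta> a \<partial>P)
      = (\<integral>a. step \<zeta> a * (step ^^ n) (step \<zeta>) a \<partial>P)"
    using step_symmetric[of \<zeta> "(step ^^ n) (step \<zeta>)"] ge2.prems by auto
  then show ?case using ge2.IH(1)[of "step \<zeta>"] ge2.prems by auto
qed

end

text \<open>
  A bounded function \<open>g\<close> of the environment determines a potential on the integers, with increment
  \<open>g (shift x a)\<close> at the edge \<open>{x, x+1}\<close>. The potential is not a function of the environment seen
  from the walk, but the moments of its increment along the walk are.
\<close>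

locale stationary_walk_gradient = stationary_walk +
  fixes g :: "(int \<Rightarrow> ennreal) \<Rightarrow> real"
  assumes bounded_g: "bounded_rv g"
begin

text \<open>
  The expected increment of the potential per unit time, as seen from the current position.
\<close>

definition drift :: "(int \<Rightarrow> ennreal) \<Rightarrow> real" where
  "drift a = b a * g a - b (shift (-1) a) * g (shift (-1) a)"

text \<open>
  First moment of the increment of the potential over \<open>n\<close> steps from the origin, obtained by
  conditioning on the first step.
\<close>

primrec mean :: "nat \<Rightarrow> (int \<Rightarrow> ennreal) \<Rightarrow> real" where
  "mean 0 = (\<lambda>a. 0)"
| "mean (Suc n) = (\<lambda>a. h * drift a + step (mean n) a)"

text \<open>
  Second moment of the same increment. The last term is the correlation between the first step and
  the remaining \<open>n\<close> steps.
\<close>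

primrec msq :: "nat \<Rightarrow> (int \<Rightarrow> ennreal) \<Rightarrow> real" where
  "msq 0 = (\<lambda>a. 0)"
| "msq (Suc n) = (\<lambda>a. step (msq n) a
     + h * (b a * (g a)\<^sup>2 + b (shift (-1) a) * (g (shift (-1) a))\<^sup>2)
     + 2 * h * (b a * g a * mean n (shift 1 a)
                - b (shift (-1) a) * g (shift (-1) a) * mean n (shift (-1) a)))"

lemma bounded_drift: "bounded_rv drift"
  unfolding drift_def[abs_def] using bounded_g by (intro bounded_rv_diff bounded_rv_mult) auto

lemma bounded_mean: "bounded_rv (mean n)"
  by (induction n) (auto intro!: bounded_rv_add bounded_rv_mult bounded_drift bounded_step)

lemma bounded_msq: "bounded_rv (msq n)"
  using bounded_g
  by (induction n) (auto intro!: bounded_rv_add bounded_rv_diff bounded_rv_mult bounded_mean)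

text \<open>
  The increment of the potential over a path starting at \<open>x\<close> depends on the environment shifted by
  \<open>x\<close> only; expanding the square of the sum of \<open>\<psi> x\<close> and this increment gives the three terms.
\<close>

lemma potential_walk_moments:
  fixes a
  defines "\<beta> \<equiv> \<lambda>x. b (shift x a)" and "\<psi> \<equiv> potential (\<lambda>x. g (shift x a))"
  shows "(walk_step h \<beta> ^^ n) (\<lambda>x. (\<psi> x)\<^sup>2) x
     = (\<psi> x)\<^sup>2 + 2 * \<psi> x * mean n (shift x a) + msq n (shift x a)"
proof (induction n arbitrary: x)
  case 0 show ?case by simp
next
  case (Suc n)
  have up: "\<psi> (x + 1) = \<psi> x + g (shift x a)" for x
    unfolding \<psi>_def by (rule potential_step)
  have dn: "\<psi> (x - 1) = \<psi> x - g (shift (x - 1) a)"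
    using up[of "x - 1"] by simp
  have sh: "shift 1 (shift x a) = shift (x + 1) a" "shift (-1) (shift x a) = shift (x - 1) a"
    by (simp_all add: shift_shift add.commute)
  have "(walk_step h \<beta> ^^ Suc n) (\<lambda>x. (\<psi> x)\<^sup>2) x
    = walk_step h \<beta> (\<lambda>x. (\<psi> x)\<^sup>2 + 2 * \<psi> x * mean n (shift x a) + msq n (shift x a)) x"
    by (simp add: Suc.IH[abs_def])
  also have "\<dots> = (\<psi> x)\<^sup>2 + 2 * \<psi> x * mean (Suc n) (shift x a) + msq (Suc n) (shift x a)"
    unfolding walk_step_def step_def drift_def up dn \<beta>_def mean.simps msq.simps sh power2_eq_square
    by (simp only: algebra_simps)
  finally show ?case .
qed

lemma mean_eq_sum: "mean n a = h * (\<Sum>j<n. (step ^^ j) drift a)"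
proof (induction n arbitrary: a)
  case 0 show ?case by simp
next
  case (Suc n)
  have "step (mean n) a = h * (\<Sum>j<n. step ((step ^^ j) drift) a)"
    unfolding step_def[of "mean n"] Suc.IH
    by (simp add: step_def sum_distrib_left sum.distrib sum_subtractf algebra_simps)
  then show ?case
    by (simp add: sum.lessThan_Suc_shift algebra_simps del: sum.lessThan_Suc)
qed

lemma expectation_drift_mean_nonneg: "0 \<le> (\<integral>a. drift a * mean n a \<partial>P)"
proof -
  have "(\<integral>a. drift a * mean n a \<partial>P) = (\<integral>a. (\<Sum>j<n. h * (drift a * (step ^^ j) drift a)) \<partial>P)"
    by (simp add: mean_eq_sum sum_distrib_left ac_simps)
  also have "\<dots> = (\<Sum>j<n. h * (\<integral>a. drift a * (step ^^ j) drift a \<partial>P))"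
    by (subst Bochner_Integration.integral_sum)
       (auto intro!: bounded_rv_integrable bounded_rv_mult bounded_drift)
  also have "\<dots> \<ge> 0"
    using h_nonneg step_funpow_nonneg_form[OF bounded_drift] by (intro sum_nonneg) auto
  finally show ?thesis .
qed

text \<open>
  After shifting the environment by one step, the correlation between the first step and the later
  displacement becomes \<open>- \<E> (drift * mean n)\<close>, which is at most zero. Each step thus contributes at
  most \<open>2 h \<E> (b g\<^sup>2)\<close>, as if the potential of the walk were a martingale.
\<close>

lemma expectation_msq_le: "(\<integral>a. msq n a \<partial>P) \<le> 2 * real n * h * (\<integral>a. b a * (g a)\<^sup>2 \<partial>P)"
proof (induction n)
  case 0 show ?case by simp
next
  case (Suc n)
  define q where "q = (\<lambda>a. b a * (g a)\<^sup>2)"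
  define u where "u = (\<lambda>a. b a * g a * mean n (shift 1 a))"
  define v where "v = (\<lambda>a. b a * g a * mean n a)"
  define u' where "u' = (\<lambda>a. b (shift (-1) a) * g (shift (-1) a) * mean n a)"
  define v' where "v' = (\<lambda>a. b (shift (-1) a) * g (shift (-1) a) * mean n (shift (-1) a))"
  have bd: "bounded_rv q" "bounded_rv u" "bounded_rv v" "bounded_rv u'" "bounded_rv v'"
    unfolding q_def u_def v_def u'_def v'_def using bounded_g bounded_mean
    by (auto intro!: bounded_rv_mult)
  have U: "(\<integral>a. u a \<partial>P) = (\<integral>a. u' a \<partial>P)"
    using integral_shift[OF bounded_rv_measurable[OF bd(2)], of "-1"]
    by (simp add: u_def u'_def shift_shift)
  have V: "(\<integral>a. v' a \<partial>P) = (\<integral>a. v a \<partial>P)"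
    using integral_shift[OF bounded_rv_measurable[OF bd(3)], of "-1"]
    by (simp add: v_def v'_def shift_shift)
  have W: "(\<integral>a. v a \<partial>P) - (\<integral>a. u' a \<partial>P) = (\<integral>a. drift a * mean n a \<partial>P)"
    using bd by (subst Bochner_Integration.integral_diff[symmetric])
      (auto simp: bounded_rv_integrable v_def u'_def drift_def algebra_simps)
  have Q: "(\<integral>a. q (shift (-1) a) \<partial>P) = (\<integral>a. q a \<partial>P)"
    by (rule integral_shift[OF bounded_rv_measurable[OF bd(1)]])
  have "(\<integral>a. msq (Suc n) a \<partial>P)
      = (\<integral>a. step (msq n) a + h * (q a + q (shift (-1) a)) + 2 * h * (u a - v' a) \<partial>P)"
    by (simp add: q_def u_def v'_def)
  also have "\<dots> = (\<integral>a. step (msq n) a \<partial>P) + h * ((\<integral>a. q a \<partial>P) + (\<integral>a. q (shift (-1) a) \<partial>P))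
      + 2 * h * ((\<integral>a. u a \<partial>P) - (\<integral>a. v' a \<partial>P))"
    using bd bounded_msq[of n]
    by (simp add: bounded_rv_integrable bounded_rv_shift bounded_step)
  also have "\<dots> = (\<integral>a. msq n a \<partial>P) + 2 * h * (\<integral>a. q a \<partial>P) - 2 * h * (\<integral>a. drift a * mean n a \<partial>P)"
    by (simp add: expectation_step bounded_msq Q U V W[symmetric] algebra_simps)
  also have "\<dots> \<le> (\<integral>a. msq n a \<partial>P) + 2 * h * (\<integral>a. q a \<partial>P)"
    using h_nonneg expectation_drift_mean_nonneg[of n] by simp
  finally show ?case using Suc.IH by (simp add: q_def algebra_simps)
qed

end

section \<open>Comparison of a continuous-time semigroup with a discrete-time walk\<close>

text \<open>
  The comparison bounds the semigroup from below, so one inequality of the Chapman-Kolmogorov equation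
  suffices, with sums over finite sets; no infinite sums of transition probabilities occur.
\<close>

locale semigroup_on_int =
  fixes p :: "real \<Rightarrow> int \<Rightarrow> int \<Rightarrow> real" and \<alpha> :: "int \<Rightarrow> real"
  assumes p_nonneg: "0 \<le> p s x y"
    and p_sum_le: "\<lbrakk>0 \<le> s; finite B\<rbrakk> \<Longrightarrow> (\<Sum>y\<in>B. p s x y) \<le> 1"
    and p_0: "p 0 x y = indicator {y} x"
    and p_chapman_kolmogorov:
      "\<lbrakk>0 \<le> s; 0 \<le> u; finite B\<rbrakk> \<Longrightarrow> (\<Sum>y\<in>B. p s x y * p u y z) \<le> p (s + u) x z"
    and p_generator:
      "((\<lambda>s. (p s x y - walk_step s \<alpha> (indicator {y}) x) / s) \<longlongrightarrow> 0) (at_right 0)"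
    and \<alpha>_pos: "0 < \<alpha> x"
begin

text \<open>
  One step of length \<open>s\<close> of the semigroup, and of the discrete-time walk, killed outside \<open>B\<close>.
\<close>

definition killed :: "int set \<Rightarrow> real \<Rightarrow> (int \<Rightarrow> real) \<Rightarrow> int \<Rightarrow> real" where
  "killed B s f x = (if x \<in> B then \<Sum>y\<in>B. p s x y * f y else 0)"

definition killed_walk :: "int set \<Rightarrow> real \<Rightarrow> (int \<Rightarrow> real) \<Rightarrow> int \<Rightarrow> real" where
  "killed_walk B s f x = (if x \<in> B then walk_step s \<alpha> (\<lambda>y. if y \<in> B then f y else 0) x else 0)"

lemma killed_Suc:
  "(killed B s ^^ Suc n) f x = (if x \<in> B then \<Sum>y\<in>B. p s x y * (killed B s ^^ n) f y else 0)"
  unfolding funpow.simps o_apply by (subst killed_def) (rule refl)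

lemma killed_walk_Suc:
  "(killed_walk B s ^^ Suc n) f x
    = (if x \<in> B then walk_step s \<alpha> (\<lambda>y. if y \<in> B then (killed_walk B s ^^ n) f y else 0) x else 0)"
  unfolding funpow.simps o_apply by (subst killed_walk_def) (rule refl)

text \<open>
  Killing at the multiples of \<open>s\<close> only loses mass.
\<close>

lemma killed_le_semigroup:
  assumes "finite B" "0 \<le> s" "\<And>y. 0 \<le> f y" "x \<in> B"
  shows "(killed B s ^^ n) f x \<le> (\<Sum>y\<in>B. p (real n * s) x y * f y)"
  using \<open>x \<in> B\<close>
proof (induction n arbitrary: x)
  case 0
  have "(\<Sum>y\<in>B. p 0 x y * f y) = (\<Sum>y\<in>B. if y = x then f y else 0)"
    by (rule sum.cong) (auto simp: p_0)
  with 0 \<open>finite B\<close> show ?case by simp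
next
  case (Suc n)
  have "(killed B s ^^ Suc n) f x = (\<Sum>y\<in>B. p s x y * (killed B s ^^ n) f y)"
    using Suc.prems by (simp add: killed_Suc del: funpow.simps)
  also have "\<dots> \<le> (\<Sum>y\<in>B. p s x y * (\<Sum>z\<in>B. p (real n * s) y z * f z))"
    by (intro sum_mono mult_left_mono Suc.IH p_nonneg)
  also have "\<dots> = (\<Sum>z\<in>B. (\<Sum>y\<in>B. p s x y * p (real n * s) y z) * f z)"
    unfolding sum_distrib_left sum_distrib_right by (subst sum.swap) (simp add: mult.assoc)
  also have "\<dots> \<le> (\<Sum>z\<in>B. p (s + real n * s) x z * f z)"
    using assms by (intro sum_mono mult_right_mono p_chapman_kolmogorov) auto
  finally show ?case by (simp add: algebra_simps)
qed

lemma killed_walk_abs_le_1: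
  assumes "0 \<le> s" "\<And>x. x \<in> B \<Longrightarrow> s * (\<alpha> x + \<alpha> (x - 1)) \<le> 1" "\<And>y. \<bar>f y\<bar> \<le> 1"
  shows "\<bar>(killed_walk B s ^^ n) f x\<bar> \<le> 1"
proof (induction n arbitrary: x)
  case 0 show ?case using assms by simp
next
  case (Suc n)
  show ?case
  proof (cases "x \<in> B")
    case True
    have "\<bar>walk_step s \<alpha> (\<lambda>y. if y \<in> B then (killed_walk B s ^^ n) f y else 0) x\<bar> \<le> 1"
      using Suc.IH by (intro walk_step_abs_le_1 assms(1) assms(2)[OF True] less_imp_le[OF \<alpha>_pos]) simp
    then show ?thesis using True by (simp add: killed_walk_Suc del: funpow.simps)
  qed (simp add: killed_walk_Suc del: funpow.simps)
qed

text \<open>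
  Both killed operators are contractions for the supremum norm, so the errors of the single steps add
  up. With \<open>n = t / s\<close> steps the sum is \<open>t * card B * e\<close>, and \<open>e\<close> can be taken arbitrarily small
  as \<open>s\<close> tends to zero, because it measures how well the generator is approximated.
\<close>

lemma killed_walk_error:
  assumes "finite B" "0 \<le> s" "\<And>x. x \<in> B \<Longrightarrow> s * (\<alpha> x + \<alpha> (x - 1)) \<le> 1" "\<And>y. \<bar>f y\<bar> \<le> 1"
    and err: "\<And>x y. x \<in> B \<Longrightarrow> y \<in> B \<Longrightarrow> \<bar>p s x y - walk_step s \<alpha> (indicator {y}) x\<bar> \<le> e * s"
    and "0 \<le> e"
  shows "\<bar>(killed B s ^^ n) f x - (killed_walk B s ^^ n) f x\<bar> \<le> real n * (real (card B) * e * s)"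
proof (induction n arbitrary: x)
  case 0 show ?case by simp
next
  case (Suc n)
  define u where "u = (killed B s ^^ n) f"
  define v where "v = (killed_walk B s ^^ n) f"
  have v1: "\<bar>v y\<bar> \<le> 1" for y
    unfolding v_def using assms by (intro killed_walk_abs_le_1) auto
  show ?case
  proof (cases "x \<in> B")
    case False
    then show ?thesis using assms by (simp add: killed_Suc killed_walk_Suc del: funpow.simps)
  next
    case True
    let ?k = "\<lambda>y. walk_step s \<alpha> (indicator {y}) x"
    let ?E = "real (card B) * e * s"
    have "(killed B s ^^ Suc n) f x - (killed_walk B s ^^ Suc n) f x
        = (\<Sum>y\<in>B. p s x y * u y) - (\<Sum>y\<in>B. ?k y * v y)"
      using True \<open>finite B\<close> by (simp add: killed_Suc killed_walk_Suc walk_step_sum u_def v_def del: funpow.simps)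
    also have "\<dots> = (\<Sum>y\<in>B. p s x y * (u y - v y)) + (\<Sum>y\<in>B. (p s x y - ?k y) * v y)"
      by (simp add: sum.distrib[symmetric] sum_subtractf[symmetric] algebra_simps)
    finally have eq: "(killed B s ^^ Suc n) f x - (killed_walk B s ^^ Suc n) f x
        = (\<Sum>y\<in>B. p s x y * (u y - v y)) + (\<Sum>y\<in>B. (p s x y - ?k y) * v y)" .
    have "\<bar>\<Sum>y\<in>B. p s x y * (u y - v y)\<bar> \<le> (\<Sum>y\<in>B. p s x y * (real n * ?E))"
      using Suc.IH p_nonneg
      by (intro order_trans[OF sum_abs] sum_mono) (simp add: abs_mult mult_left_mono u_def v_def)
    also have "\<dots> \<le> 1 * (real n * ?E)"
      unfolding sum_distrib_right[symmetric] using assms p_sum_le by (intro mult_right_mono) auto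
    finally have 1: "\<bar>\<Sum>y\<in>B. p s x y * (u y - v y)\<bar> \<le> real n * ?E" by simp
    have "\<bar>\<Sum>y\<in>B. (p s x y - ?k y) * v y\<bar> \<le> (\<Sum>y\<in>B. (e * s) * 1)"
      using True assms(2) \<open>0 \<le> e\<close> v1 err
      by (intro order_trans[OF sum_abs] sum_mono, unfold abs_mult)
        (rule mult_mono, auto)
    then have 2: "\<bar>\<Sum>y\<in>B. (p s x y - ?k y) * v y\<bar> \<le> ?E" by simp
    show ?thesis unfolding eq
      using order_trans[OF abs_triangle_ineq add_mono[OF 1 2]] by (simp add: algebra_simps)
  qed
qed

text \<open>
  The walk that is not killed exceeds the killed one by at most the probability of leaving \<open>B\<close>, and
  this is bounded by the optional stopping argument for the supermartingale \<open>w - k * time\<close>, carried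
  out by induction on the number of steps. Outside \<open>B\<close> the bound is trivial since \<open>w \<ge> W\<close> there.
  The conductances of the two walks need only agree on edges that meet \<open>B\<close>.
\<close>

lemma killed_walk_ge:
  assumes B: "lazy_walk s \<beta>" "\<And>x. x \<in> B \<Longrightarrow> \<beta> x = \<alpha> x \<and> \<beta> (x - 1) = \<alpha> (x - 1)"
    and f: "\<And>y. 0 \<le> f y" "\<And>y. f y \<le> 1" "\<And>y. y \<notin> B \<Longrightarrow> f y = 0"
    and w: "\<And>x. 0 \<le> w x" "\<And>x. x \<notin> B \<Longrightarrow> W \<le> w x" "0 < W"
      "\<And>x. x \<in> B \<Longrightarrow> walk_step s \<alpha> w x \<le> w x + k * s" and "0 \<le> k"
  shows "(walk_step s \<beta> ^^ n) f x - (killed_walk B s ^^ n) f x \<le> (w x + k * s * real n) / W"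
proof (induction n arbitrary: x)
  case 0 show ?case using w by simp
next
  case (Suc n)
  interpret lazy_walk s \<beta> by (rule B)
  define u where "u = (walk_step s \<beta> ^^ n) f"
  define v where "v = (killed_walk B s ^^ n) f"
  show ?case
  proof (cases "x \<in> B")
    case False
    have "(walk_step s \<beta> ^^ Suc n) f x \<le> (walk_step s \<beta> ^^ Suc n) (\<lambda>y. 0 * f y + 1) x"
      using f by (intro funpow_mono) auto
    also have "\<dots> = 1" by (subst funpow_affine) simp
    also have "\<dots> \<le> (w x + k * s * real (Suc n)) / W"
    proof -
      have "W \<le> w x + k * s * real (Suc n)" using w(2)[OF False] h0 \<open>0 \<le> k\<close>
        by (smt (verit) mult_nonneg_nonneg of_nat_0_le_iff)
      then show ?thesis using w(3) by simp
    qed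
    finally show ?thesis using False by (simp add: killed_walk_Suc del: funpow.simps)
  next
    case True
    \<comment> \<open>A killed function vanishes outside \<open>B\<close>, so cutting it off there again changes nothing.\<close>
    have supp: "(if y \<in> B then v y else 0) = v y" for y
      unfolding v_def using f(3) by (cases n) (auto simp: killed_walk_Suc simp del: funpow.simps(2))
    have "(walk_step s \<beta> ^^ Suc n) f x - (killed_walk B s ^^ Suc n) f x
        = walk_step s \<beta> u x - walk_step s \<alpha> v x"
      using True unfolding killed_walk_Suc v_def[symmetric] supp by (simp add: u_def)
    also have "\<dots> = walk_step s \<beta> (\<lambda>y. u y - v y) x"
      using B(2)[OF True] by (simp add: walk_step_def algebra_simps)
    also have "\<dots> \<le> walk_step s \<beta> (\<lambda>y. (w y + k * s * real n) / W) x"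
      using Suc.IH by (intro walk_step_mono h0 \<beta>0 lz) (simp add: u_def v_def)
    also have "\<dots> = walk_step s \<beta> (\<lambda>y. (1 / W) * w y + k * s * real n / W) x"
      by (simp add: add_divide_distrib)
    also have "\<dots> = (walk_step s \<alpha> w x + k * s * real n) / W"
      unfolding walk_step_affine using B(2)[OF True] by (simp add: walk_step_def add_divide_distrib)
    also have "\<dots> \<le> (w x + k * s * real (Suc n)) / W"
      using w(3) w(4)[OF True] by (intro divide_right_mono) (auto simp: algebra_simps)
    finally show ?thesis .
  qed
qed

text \<open>
  The Lyapunov function that rules out explosion. Its flux \<open>2 x + 1\<close> through the edge \<open>{x, x+1}\<close>
  increases by 2 from each edge to the next, so the generator maps it to the constant 2. On
  an edge and its mirror image in the origin the flux has opposite values, so that the function grows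
  in both directions at least as fast as the resistance.
\<close>

definition barrier :: "int \<Rightarrow> real" where
  "barrier = potential (\<lambda>x. (2 * of_int x + 1) / \<alpha> x)"

lemma barrier_step: "walk_step s \<alpha> barrier x = barrier x + 2 * s"
proof -
  have flux: "\<alpha> x * (barrier (x + 1) - barrier x) = 2 * of_int x + 1" for x
    using \<alpha>_pos[of x] by (simp add: barrier_def potential_step)
  have "\<alpha> (x - 1) * (barrier (x - 1) - barrier x) = - (2 * of_int x - 1)"
    using flux[of "x - 1"] by (simp add: algebra_simps)
  then show ?thesis
    by (simp add: walk_step_def flux)
qed

lemma barrier_ge: "\<bar>potential (\<lambda>x. 1 / \<alpha> x) x\<bar> \<le> barrier x"
proof (cases "x \<ge> 0")
  case True
  then have "potential (\<lambda>x. 1 / \<alpha> x) x = (\<Sum>y\<in>{0..<x}. 1 / \<alpha> y)"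
    "barrier x = (\<Sum>y\<in>{0..<x}. (2 * of_int y + 1) / \<alpha> y)"
    by (simp_all add: potential_def barrier_def)
  moreover have "0 \<le> (\<Sum>y\<in>{0..<x}. 1 / \<alpha> y)"
    using \<alpha>_pos by (intro sum_nonneg) (simp add: less_imp_le)
  moreover have "(\<Sum>y\<in>{0..<x}. 1 / \<alpha> y) \<le> (\<Sum>y\<in>{0..<x}. (2 * of_int y + 1) / \<alpha> y)"
    using \<alpha>_pos by (intro sum_mono divide_right_mono) (auto simp: less_imp_le)
  ultimately show ?thesis by simp
next
  case False
  then have "potential (\<lambda>x. 1 / \<alpha> x) x = - (\<Sum>y\<in>{x..<0}. 1 / \<alpha> y)"
    "barrier x = - (\<Sum>y\<in>{x..<0}. (2 * of_int y + 1) / \<alpha> y)"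
    by (simp_all add: potential_def barrier_def)
  moreover have "0 \<le> (\<Sum>y\<in>{x..<0}. 1 / \<alpha> y)"
    using \<alpha>_pos by (intro sum_nonneg) (simp add: less_imp_le)
  moreover have "(\<Sum>y\<in>{x..<0}. 1 / \<alpha> y) \<le> - (\<Sum>y\<in>{x..<0}. (2 * of_int y + 1) / \<alpha> y)"
    unfolding sum_negf[symmetric] minus_divide_left
    using \<alpha>_pos by (intro sum_mono divide_right_mono) (auto simp: less_imp_le)
  ultimately show ?thesis by simp
qed

text \<open>
  Choose a box \<open>B\<close> so large that the barrier outside exceeds \<open>4 t / \<epsilon>\<close>; leaving it before time
  \<open>t\<close> then costs at most \<open>\<epsilon> / 2\<close>, uniformly in \<open>n\<close>. For this box and \<open>n\<close> large the conductances
  are not truncated near \<open>B\<close>, and the time discretisation costs another \<open>\<epsilon> / 2\<close>.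
\<close>

theorem semigroup_le_walk:
  assumes t: "0 < t" and S: "finite S"
    and right: "filterlim (potential (\<lambda>x. 1 / \<alpha> x)) at_top at_top"
    and left: "filterlim (potential (\<lambda>x. 1 / \<alpha> x)) at_bot at_bot"
    and \<epsilon>: "0 < \<epsilon>"
  shows "\<forall>\<^sub>F n in sequentially. 1 - (\<Sum>y\<in>S. p t 0 y)
    \<le> (walk_step (t / real n) (\<lambda>x. min (\<alpha> x) (real n / (4 * t))) ^^ n) (indicator (- S)) 0 + \<epsilon>"
proof -
  define W where "W = 4 * t / \<epsilon>"
  have W: "0 < W" "2 * t / W = \<epsilon> / 2" using t \<epsilon> by (auto simp: W_def)
  from right have "\<forall>\<^sub>F x in at_top. W \<le> potential (\<lambda>x. 1 / \<alpha> x) x" by (simp add: filterlim_at_top)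
  then obtain N1 where N1: "\<And>x. N1 \<le> x \<Longrightarrow> W \<le> potential (\<lambda>x. 1 / \<alpha> x) x"
    by (auto simp: eventually_at_top_linorder)
  from left have "\<forall>\<^sub>F x in at_bot. potential (\<lambda>x. 1 / \<alpha> x) x \<le> - W" by (simp add: filterlim_at_bot)
  then obtain N2 where N2: "\<And>x. x \<le> N2 \<Longrightarrow> potential (\<lambda>x. 1 / \<alpha> x) x \<le> - W"
    by (auto simp: eventually_at_bot_linorder)
  obtain l u where lu: "S \<subseteq> {l..u}"
    using S bdd_above_finite[OF S] bdd_below_finite[OF S] by (auto simp: bdd_above_def bdd_below_def subset_eq)
  define B where "B = {min (min l N2) 0..max (max u N1) 0}"
  have B: "finite B" "0 \<in> B" "S \<subseteq> B"
    using lu by (auto simp: B_def min_le_iff_disj le_max_iff_disj subset_eq)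
  have wB: "W \<le> barrier x" if "x \<notin> B" for x
  proof -
    have "x \<le> N2 \<or> N1 \<le> x" using that by (auto simp: B_def)
    then show ?thesis using N1[of x] N2[of x] barrier_ge[of x] by linarith
  qed
  \<comment> \<open>Chosen so that the accumulated discretisation error is \<open>\<epsilon> / 2\<close>.\<close>
  define e where "e = \<epsilon> / (2 * t * real (card B))"
  have "0 < card B" using B by (auto simp: card_gt_0_iff)
  then have e: "0 < e" "t * real (card B) * e = \<epsilon> / 2" using \<epsilon> t by (auto simp: e_def)
  have tn: "filterlim (\<lambda>n. t / real n) (at_right 0) sequentially"
    unfolding filterlim_at
  proof
    show "\<forall>\<^sub>F n in sequentially. t / real n \<in> {0<..} \<and> t / real n \<noteq> 0"
      using eventually_gt_at_top[of 0] by eventually_elim (use t in simp)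
  qed (rule lim_const_over_n)
  have "\<forall>\<^sub>F s in at_right 0. \<forall>x\<in>B. \<forall>y\<in>B. \<bar>p s x y - walk_step s \<alpha> (indicator {y}) x\<bar> \<le> e * s"
  proof (intro eventually_ball_finite B ballI)
    fix x y
    have "\<forall>\<^sub>F s in at_right 0. dist ((p s x y - walk_step s \<alpha> (indicator {y}) x) / s) 0 < e"
      using p_generator e(1) by (rule tendstoD)
    moreover have "\<forall>\<^sub>F s in at_right 0. (0::real) < s"
      by (simp add: eventually_at_right_less)
    ultimately show "\<forall>\<^sub>F s in at_right 0. \<bar>p s x y - walk_step s \<alpha> (indicator {y}) x\<bar> \<le> e * s"
      by eventually_elim (simp add: dist_real_def divide_simps less_imp_le)
  qed
  then have ev1: "\<forall>\<^sub>F n in sequentially. \<forall>x\<in>B. \<forall>y\<in>B.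
      \<bar>p (t / real n) x y - walk_step (t / real n) \<alpha> (indicator {y}) x\<bar> \<le> e * (t / real n)"
    using tn by (rule eventually_compose_filterlim)
  have ev2: "\<forall>\<^sub>F n in sequentially. \<forall>x\<in>B. \<alpha> x \<le> real n / (4 * t) \<and> \<alpha> (x - 1) \<le> real n / (4 * t)"
  proof (intro eventually_ball_finite B ballI eventually_conj)
    have "\<forall>\<^sub>F n in sequentially. z \<le> real n / (4 * t)" for z
      using eventually_ge_at_top[of "nat \<lceil>z * (4 * t)\<rceil>"]
    proof eventually_elim
      case (elim n)
      then have "z * (4 * t) \<le> real n" by linarith
      then show ?case using t by (simp add: pos_le_divide_eq)
    qed
    then show "\<forall>\<^sub>F n in sequentially. \<alpha> x \<le> real n / (4 * t)" 
      "\<forall>\<^sub>F n in sequentially. \<alpha> (x - 1) \<le> real n / (4 * t)" for x by auto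
  qed
  show ?thesis
    using ev1 ev2 eventually_gt_at_top[of 0]
  proof eventually_elim
    case (elim n)
    define s where "s = t / real n"
    define \<beta> where "\<beta> = (\<lambda>x. min (\<alpha> x) (real n / (4 * t)))"
    define f where "f = (indicator S :: int \<Rightarrow> real)"
    have s: "0 \<le> s" "real n * s = t" "s * (real n / (4 * t)) = 1 / 4" using t elim by (auto simp: s_def)
    have quarter: "s * \<beta> x \<le> 1 / 4" for x
      unfolding s(3)[symmetric] \<beta>_def using s by (intro mult_left_mono) auto
    have half: "s * (\<beta> x + \<beta> (x - 1)) \<le> 1" for x
      using add_mono[OF quarter[of x] quarter[of "x - 1"]] by (simp add: distrib_left)
    have lazy: "lazy_walk s \<beta>"
      using s half \<alpha>_pos t by unfold_locales (auto simp: \<beta>_def less_imp_le)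
    have \<beta>\<alpha>: "\<beta> x = \<alpha> x \<and> \<beta> (x - 1) = \<alpha> (x - 1)" if "x \<in> B" for x
      using elim(2) that by (auto simp: \<beta>_def)
    have sub: "s * (\<alpha> x + \<alpha> (x - 1)) \<le> 1" if "x \<in> B" for x
      using half[of x] \<beta>\<alpha>[OF that] by simp
    have f: "0 \<le> f y" "f y \<le> 1" "\<bar>f y\<bar> \<le> 1" "y \<notin> B \<Longrightarrow> f y = 0" for y
      using B by (auto simp: f_def indicator_def)
    have "(walk_step s \<beta> ^^ n) f 0 - (killed_walk B s ^^ n) f 0 \<le> (barrier 0 + 2 * s * real n) / W"
      by (rule killed_walk_ge[OF lazy \<beta>\<alpha> f(1,2,4) _ wB W(1)])
        (auto simp: barrier_step intro: order_trans[OF abs_ge_zero barrier_ge])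
    also have "\<dots> = \<epsilon> / 2" 
    proof -
      have "barrier 0 + 2 * s * real n = 2 * t" using s(2) by (simp add: barrier_def mult.commute)
      then show ?thesis using W(2) by simp
    qed
    finally have 1: "(walk_step s \<beta> ^^ n) f 0 - (killed_walk B s ^^ n) f 0 \<le> \<epsilon> / 2" .
    have "\<bar>(killed B s ^^ n) f 0 - (killed_walk B s ^^ n) f 0\<bar> \<le> real n * (real (card B) * e * s)"
      using elim(1) s sub f e by (intro killed_walk_error B) (auto simp: s_def[symmetric])
    also have "\<dots> = (real n * s) * real (card B) * e" by simp
    finally have 2: "\<bar>(killed B s ^^ n) f 0 - (killed_walk B s ^^ n) f 0\<bar> \<le> \<epsilon> / 2"
      unfolding s(2) e(2) .
    have "(killed B s ^^ n) f 0 \<le> (\<Sum>y\<in>B. p (real n * s) 0 y * f y)"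
      using s f B by (intro killed_le_semigroup) auto
    also have "\<dots> = (\<Sum>y\<in>S. p t 0 y)"
      unfolding s(2) using B by (intro sum.mono_neutral_cong_right) (auto simp: f_def)
    finally have 3: "(killed B s ^^ n) f 0 \<le> (\<Sum>y\<in>S. p t 0 y)" .
    have "indicator (- S) = (\<lambda>y. (-1) * f y + 1)" by (auto simp: f_def indicator_def)
    then have "(walk_step s \<beta> ^^ n) (indicator (- S)) 0 = 1 - (walk_step s \<beta> ^^ n) f 0"
      using lazy_walk.funpow_affine[OF lazy, of n "-1" f 1 0] by simp
    then show ?case using 1 2 3 unfolding s_def[symmetric] \<beta>_def[symmetric] by linarith
  qed
qed

end

section \<open>Markov chains among random conductances\<close>

lemma (in prob_space) sum_prob_eq:
  assumes "finite B" and [measurable]: "Y \<in> measurable M (count_space UNIV)"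
    and [measurable]: "Measurable.pred M R"
  shows "(\<Sum>y\<in>B. prob {w \<in> space M. Y w = y \<and> R w}) = prob {w \<in> space M. Y w \<in> B \<and> R w}"
proof -
  have "prob (\<Union>y\<in>B. {w \<in> space M. Y w = y \<and> R w}) = (\<Sum>y\<in>B. prob {w \<in> space M. Y w = y \<and> R w})"
  proof (rule finite_measure_finite_Union)
    show "(\<lambda>y. {w \<in> space M. Y w = y \<and> R w}) ` B \<subseteq> events" by auto
  qed (use \<open>finite B\<close> in \<open>auto simp: disjoint_family_on_def\<close>)
  moreover have "(\<Union>y\<in>B. {w \<in> space M. Y w = y \<and> R w}) = {w \<in> space M. Y w \<in> B \<and> R w}" by auto
  ultimately show ?thesis by simp
qed

lemma walk_step_gen: "walk_step s (\<lambda>x. enn2real (a x)) f x = f x + s * gen a f x"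
  by (simp add: walk_step_def gen_def cond_def)

locale conductance_chain =
  fixes a :: "int \<Rightarrow> ennreal" and Q :: "int \<Rightarrow> 'w measure" and X :: "real \<Rightarrow> 'w \<Rightarrow> int"
  assumes ctmc: "ctmc (gen a) Q X"
    and pos: "0 < a x" and fin: "a x < \<infinity>"
begin

abbreviation conductance :: "int \<Rightarrow> real" where
  "conductance \<equiv> \<lambda>x. enn2real (a x)"

definition transition :: "real \<Rightarrow> int \<Rightarrow> int \<Rightarrow> real" where
  "transition t x y = measure (Q x) {w \<in> space (Q x). X t w = y}"

lemma prob_space_Q: "prob_space (Q x)"
  using ctmc by (simp add: ctmc_def)

lemma X_measurable: "0 \<le> t \<Longrightarrow> X t \<in> measurable (Q x) (count_space UNIV)"
  using ctmc by (simp add: ctmc_def)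

lemma start: "AE w in Q x. X 0 w = x"
  using ctmc by (simp add: ctmc_def)

lemma markov:
  assumes "0 \<le> s" "0 \<le> u"
  shows "measure (Q x) {w \<in> space (Q x). X s w = y \<and> X (s + u) w = z}
    = transition s x y * transition u y z"
proof -
  have "\<forall>x (n::nat) (s::nat \<Rightarrow> real) y t z. 0 \<le> s 0 \<and> mono_on {..n} s \<and> 0 \<le> t \<longrightarrow>
        measure (Q x) {w \<in> space (Q x). (\<forall>i\<le>n. X (s i) w = y i) \<and> X (s n + t) w = z} =
        measure (Q x) {w \<in> space (Q x). \<forall>i\<le>n. X (s i) w = y i} *
        measure (Q (y n)) {w \<in> space (Q (y n)). X t w = z}"
    using ctmc by (simp add: ctmc_def)
  from this[rule_format, of "\<lambda>_. s" 0 u x "\<lambda>_. y" z] assms show ?thesis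
    by (simp add: transition_def mono_on_def)
qed

lemma generator: "finite {y. f y \<noteq> 0} \<Longrightarrow>
    ((\<lambda>t. \<integral>w. f (X t w) \<partial>Q x) has_real_derivative gen a f x) (at 0 within {0..})"
  using ctmc by (simp add: ctmc_def)

lemma sum_transition:
  assumes "0 \<le> t" "finite B"
  shows "(\<Sum>y\<in>B. transition t x y) = measure (Q x) {w \<in> space (Q x). X t w \<in> B}"
  using prob_space.sum_prob_eq[OF prob_space_Q assms(2) X_measurable[OF assms(1)], of "\<lambda>_. True"]
  by (simp add: transition_def)

lemma transition_0: "transition 0 x y = indicator {y} x"
proof -
  interpret prob_space "Q x" by (rule prob_space_Q)
  have [measurable]: "X 0 \<in> measurable (Q x) (count_space UNIV)" by (rule X_measurable) simp
  have ev: "{w \<in> space (Q x). X 0 w = y} \<in> events" by measurable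
  show ?thesis
  proof (cases "x = y")
    case True
    have "prob {w \<in> space (Q x). X 0 w = y} = 1"
      using start[of x] True ev by (subst prob_Collect_eq_1) auto
    then show ?thesis using True by (simp add: transition_def)
  next
    case False
    have "prob {w \<in> space (Q x). X 0 w = y} = 0"
      using start[of x] False ev by (subst prob_Collect_eq_0) auto
    then show ?thesis using False by (simp add: transition_def)
  qed
qed

sublocale semigroup_on_int transition conductance
proof
  fix s u :: real and x y z :: int and B :: "int set"
  interpret prob_space "Q x" by (rule prob_space_Q)
  show "0 \<le> transition s x y" by (simp add: transition_def)
  show "0 < conductance x" using pos[of x] fin[of x] by (simp add: enn2real_positive_iff)
  show "transition 0 x y = indicator {y} x" by (rule transition_0)
  show "(\<Sum>y\<in>B. transition s x y) \<le> 1" if "0 \<le> s" "finite B"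
    using that by (simp add: sum_transition)
  show "(\<Sum>y\<in>B. transition s x y * transition u y z) \<le> transition (s + u) x z"
    if "0 \<le> s" "0 \<le> u" "finite B"
  proof -
    have [measurable]: "X s \<in> measurable (Q x) (count_space UNIV)"
      "X (s + u) \<in> measurable (Q x) (count_space UNIV)"
      using that by (auto intro: X_measurable)
    have "(\<Sum>y\<in>B. transition s x y * transition u y z)
        = prob {w \<in> space (Q x). X s w \<in> B \<and> X (s + u) w = z}"
      using that by (simp add: markov[symmetric] sum_prob_eq)
    also have "\<dots> \<le> prob {w \<in> space (Q x). X (s + u) w = z}"
      by (rule finite_measure_mono) auto
    finally show ?thesis by (simp add: transition_def)
  qed
  show "((\<lambda>s. (transition s x y - walk_step s conductance (indicator {y}) x) / s) \<longlongrightarrow> 0) (at_right 0)"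
  proof -
    let ?f = "indicator {y} :: int \<Rightarrow> real"
    have tr: "(\<integral>w. ?f (X t w) \<partial>Q x) = transition t x y" if "0 \<le> t" for t
    proof -
      have [measurable]: "X t \<in> measurable (Q x) (count_space UNIV)" using that by (rule X_measurable)
      have "(\<integral>w. ?f (X t w) \<partial>Q x) = (\<integral>w. indicator {w \<in> space (Q x). X t w = y} w \<partial>Q x)"
        by (rule Bochner_Integration.integral_cong) (auto simp: indicator_def)
      then show ?thesis by (simp add: transition_def)
    qed
    have "((\<lambda>t. \<integral>w. ?f (X t w) \<partial>Q x) has_real_derivative gen a ?f x) (at 0 within {0..})"
      by (rule generator) (simp add: indicator_def)
    then have "((\<lambda>t. ((\<integral>w. ?f (X t w) \<partial>Q x) - (\<integral>w. ?f (X 0 w) \<partial>Q x)) / (t - 0)) \<longlongrightarrow> gen a ?f x)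
        (at 0 within {0..})"
      by (simp only: has_field_derivative_iff)
    then have "((\<lambda>t. ((\<integral>w. ?f (X t w) \<partial>Q x) - (\<integral>w. ?f (X 0 w) \<partial>Q x)) / (t - 0)) \<longlongrightarrow> gen a ?f x)
        (at_right 0)"
      by (rule tendsto_within_subset) auto
    then have "((\<lambda>t. ((\<integral>w. ?f (X t w) \<partial>Q x) - (\<integral>w. ?f (X 0 w) \<partial>Q x)) / (t - 0) - gen a ?f x) \<longlongrightarrow> 0)
        (at_right 0)"
      by (simp only: LIM_zero)
    moreover have "\<forall>\<^sub>F t in at_right 0.
        ((\<integral>w. ?f (X t w) \<partial>Q x) - (\<integral>w. ?f (X 0 w) \<partial>Q x)) / (t - 0) - gen a ?f x
        = (transition t x y - walk_step t conductance ?f x) / t"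
      using eventually_at_right_less[of 0]
      by eventually_elim (simp add: tr transition_0 walk_step_gen field_simps)
    ultimately show ?thesis by (rule Lim_transform_eventually)
  qed
qed

text \<open>
  Divergence of the resistance in both directions makes the barrier tend to infinity, so no mass is lost
  in the comparison and the tail can be estimated through the complementary, finite set of positions.
\<close>

theorem tail_le_liminf:
  assumes t: "0 < t"
    and right: "filterlim (potential (\<lambda>x. 1 / conductance x)) at_top at_top"
    and left: "filterlim (potential (\<lambda>x. 1 / conductance x)) at_bot at_bot"
  shows "emeasure (Q 0) {w \<in> space (Q 0). R \<le> \<bar>real_of_int (X t w)\<bar>}
    \<le> liminf (\<lambda>n. ennreal ((walk_step (t / real n) (\<lambda>x. min (conductance x) (real n / (4 * t))) ^^ n)
         (indicator {x. R \<le> \<bar>real_of_int x\<bar>}) 0))"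
    (is "_ \<le> liminf (\<lambda>n. ennreal (?u n))")
proof -
  interpret prob_space "Q 0" by (rule prob_space_Q)
  have [measurable]: "X t \<in> measurable (Q 0) (count_space UNIV)" using t by (intro X_measurable) simp
  define S where "S = {x::int. \<bar>real_of_int x\<bar> < R}"
  have "S \<subseteq> {- \<lceil>R\<rceil>..\<lceil>R\<rceil>}"
  proof
    fix x assume "x \<in> S"
    then have "\<bar>real_of_int x\<bar> < R" by (simp add: S_def)
    then show "x \<in> {- \<lceil>R\<rceil>..\<lceil>R\<rceil>}" by (simp, linarith)
  qed
  then have S: "finite S" by (rule finite_subset) simp
  have compl: "- S = {x. R \<le> \<bar>real_of_int x\<bar>}" by (auto simp: S_def)
  define q where "q = prob {w \<in> space (Q 0). R \<le> \<bar>real_of_int (X t w)\<bar>}"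
  have "{w \<in> space (Q 0). R \<le> \<bar>real_of_int (X t w)\<bar>} = space (Q 0) - {w \<in> space (Q 0). X t w \<in> S}"
    by (auto simp: S_def)
  then have q: "q = 1 - (\<Sum>y\<in>S. transition t 0 y)"
    using t S unfolding q_def by (simp add: sum_transition prob_compl)
  have "ennreal q \<le> liminf (\<lambda>n. ennreal (?u n))"
    unfolding le_Liminf_iff
  proof (intro allI impI)
    fix z :: ennreal assume z: "z < ennreal q"
    then obtain r where r: "z = ennreal r" "0 \<le> r" by (cases z) auto
    then have rq: "r < q" using z by (simp add: ennreal_less_iff)
    have "\<forall>\<^sub>F n in sequentially. 1 - (\<Sum>y\<in>S. transition t 0 y) \<le> ?u n + (q - r) / 2"
      using semigroup_le_walk[OF t S right left, of "(q - r) / 2"] rq unfolding compl by simp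
    then show "\<forall>\<^sub>F n in sequentially. z < ennreal (?u n)"
    proof eventually_elim
      case (elim n)
      then have "r < ?u n" using rq unfolding q by argo
      then show ?case using r by (simp add: ennreal_lessI)
    qed
  qed
  then show ?thesis by (simp add: q_def emeasure_eq_measure)
qed

end

section \<open>Environments of infinite mean resistance\<close>

lemma shift_funpow: "(shift z ^^ i) a = shift (int i * z) a"
  by (induction i) (auto simp: shift_shift algebra_simps)

locale infinite_resistance_environment = stationary_environment +
  assumes ergodic: "ergodic P"
    and positive: "AE a in P. \<forall>x. 0 < a x"
    and finite_0: "AE a in P. a 0 < \<infinity>"
    and infinite_resistance: "(\<integral>\<^sup>+a. inverse (a 0) \<partial>P) = \<infinity>"
begin

lemma prob_UNIV [simp]: "prob UNIV = 1"
  using prob_space by simp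

lemma finite_conductances: "AE a in P. \<forall>x. a x < \<infinity>"
proof -
  have "AE a in P. a x < \<infinity>" for x
    using AE_shift[OF finite_0, of x] by (simp add: shift_def)
  then show ?thesis by (simp add: AE_all_countable)
qed

text \<open>
  A set invariant under one generator of the group of shifts is invariant under all of them.
\<close>

lemma ergodic_shift:
  assumes "z = 1 \<or> z = -1" "A \<in> sets P" "shift z -` A \<inter> space P = A"
  shows "prob A = 0 \<or> prob A = 1"
proof -
  have inv: "shift z a \<in> A \<longleftrightarrow> a \<in> A" for a using assms(3) by auto
  have inv': "shift (- z) a \<in> A \<longleftrightarrow> a \<in> A" for a
    using inv[of "shift (- z) a"] by (simp add: shift_shift)
  have "shift (int n * z) a \<in> A \<longleftrightarrow> a \<in> A" "shift (int n * - z) a \<in> A \<longleftrightarrow> a \<in> A" for n a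
    unfolding shift_funpow[symmetric] by (induction n) (auto simp: inv inv')
  note iter = this
  have "shift y a \<in> A \<longleftrightarrow> a \<in> A" for y a
    using assms(1) iter[of "nat y" a] iter[of "nat (- y)" a] by (cases "y \<ge> 0") auto
  then have "\<forall>y. shift y -` A = A" by auto
  then show ?thesis using ergodic assms(2) sets_P by (simp add: ergodic_def)
qed

text \<open>
  The cut-off makes the resistance bounded and keeps its product with the conductance at most one, so
  that the energy of the potential with these increments is at most their mean.
\<close>

definition resistance :: "real \<Rightarrow> (int \<Rightarrow> ennreal) \<Rightarrow> real" where
  "resistance \<epsilon> a = 1 / max (enn2real (a 0)) \<epsilon>"

definition mean_resistance :: "real \<Rightarrow> real" where
  "mean_resistance \<epsilon> = (\<integral>a. resistance \<epsilon> a \<partial>P)"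

lemma resistance_pos: "0 < \<epsilon> \<Longrightarrow> 0 < resistance \<epsilon> a"
  by (simp add: resistance_def)

lemma resistance_le: "0 < \<epsilon> \<Longrightarrow> resistance \<epsilon> a \<le> 1 / \<epsilon>"
  by (simp add: resistance_def frac_le)

lemma resistance_measurable [measurable]: "resistance \<epsilon> \<in> borel_measurable P"
  unfolding resistance_def[abs_def] by measurable

lemma bounded_resistance: "0 < \<epsilon> \<Longrightarrow> bounded_rv (resistance \<epsilon>)"
  using resistance_le resistance_pos[THEN less_imp_le]
  by (intro bounded_rvI[where C="1 / \<epsilon>"]) auto

text \<open>
  Fatou's lemma along \<open>\<epsilon> = 1 / (n + 1)\<close>, for which the cut-off resistance is eventually equal to the
  resistance.
\<close>

lemma mean_resistance_unbounded: "\<exists>\<epsilon>>0. C < mean_resistance \<epsilon>"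
proof (rule ccontr)
  assume "\<not> ?thesis"
  then have le: "mean_resistance (1 / real (Suc n)) \<le> C" for n
    by (metis not_le of_nat_0_less_iff zero_less_Suc zero_less_divide_1_iff)
  let ?r = "\<lambda>n a. ennreal (resistance (1 / real (Suc n)) a)"
  have "AE a in P. inverse (a 0) = liminf (\<lambda>n. ?r n a)"
    using positive finite_conductances
  proof eventually_elim
    case (elim a)
    then have a: "0 < a 0" "a 0 < \<infinity>" by auto
    then obtain r where r: "a 0 = ennreal r" "0 < r"
      by (cases "a 0") (auto simp: less_le)
    have "\<forall>\<^sub>F n in sequentially. 1 / real (Suc n) < r"
      using LIMSEQ_inverse_real_of_nat r(2) by (auto simp: inverse_eq_divide intro: order_tendstoD)
    then have "\<forall>\<^sub>F n in sequentially. ?r n a = inverse (a 0)"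
    proof eventually_elim
      case (elim n)
      then have "resistance (1 / real (Suc n)) a = inverse r"
        using r by (simp add: resistance_def max_def inverse_eq_divide)
      then show ?case using r by (simp add: inverse_ennreal)
    qed
    then have "(\<lambda>n. ?r n a) \<longlonglongrightarrow> inverse (a 0)" by (rule tendsto_eventually)
    then show ?case by (simp add: lim_imp_Liminf)
  qed
  then have "(\<integral>\<^sup>+a. inverse (a 0) \<partial>P) = (\<integral>\<^sup>+a. liminf (\<lambda>n. ?r n a) \<partial>P)"
    by (rule nn_integral_cong_AE)
  also have "\<dots> \<le> liminf (\<lambda>n. \<integral>\<^sup>+a. ?r n a \<partial>P)"
    by (rule nn_integral_liminf) auto
  also have "\<dots> \<le> liminf (\<lambda>n. ennreal C)"
  proof (rule Liminf_mono, rule always_eventually, rule allI)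
    fix n
    have "(\<integral>\<^sup>+a. ?r n a \<partial>P) = ennreal (mean_resistance (1 / real (Suc n)))"
      unfolding mean_resistance_def
      by (intro nn_integral_eq_integral bounded_rv_integrable bounded_resistance)
         (auto intro!: AE_I2 less_imp_le resistance_pos)
    then show "(\<integral>\<^sup>+a. ?r n a \<partial>P) \<le> ennreal C" using le by (simp add: ennreal_leI)
  qed
  finally show False using infinite_resistance by (simp add: Liminf_const top_unique)
qed

text \<open>
  The partial sums of \<open>3 m / 4 - g\<close> are bounded above since its mean \<open>- m / 4\<close> is negative; the
  difference between \<open>3 m / 4\<close> and \<open>m / 2\<close> absorbs the bound.
\<close>

lemma birkhoff_lower:
  assumes z: "z = 1 \<or> z = -1" and g: "bounded_rv g" and m: "0 < (\<integral>a. g a \<partial>P)"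
  shows "AE a in P. \<forall>\<^sub>F n in sequentially.
    real n * (\<integral>a. g a \<partial>P) / 2 \<le> (\<Sum>i<n. g (shift (int i * z) a))"
proof -
  define m where "m = (\<integral>a. g a \<partial>P)"
  define f where "f = (\<lambda>a. 3 / 4 * m - g a)"
  have f: "bounded_rv f" unfolding f_def using g by (intro bounded_rv_diff) auto
  then obtain C where C: "\<And>a. \<bar>f a\<bar> \<le> C" by (auto simp: bounded_rv_def)
  have "(\<integral>a. f a \<partial>P) = - m / 4"
    using g by (simp add: f_def bounded_rv_integrable prob_space m_def[symmetric])
  then have neg: "(\<integral>a. f a \<partial>P) < 0" using m by (simp add: m_def)
  have "AE a in P. \<exists>B. \<forall>n. (\<Sum>i<n. f ((shift z ^^ i) a)) \<le> B"
    by (rule birkhoff_sums_bounded_above[OF shift_measurable distr_shift ergodic_shift[OF z]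
        bounded_rv_measurable[OF f] C neg])
  then show ?thesis
  proof eventually_elim
    case (elim a)
    then obtain B where B: "\<And>n. (\<Sum>i<n. f (shift (int i * z) a)) \<le> B"
      by (auto simp: shift_funpow)
    have S: "3 / 4 * m * real n - B \<le> (\<Sum>i<n. g (shift (int i * z) a))" for n
      using B[of n] by (simp add: f_def sum_subtractf mult.commute)
    have m': "0 < m" using m by (simp add: m_def)
    have "\<forall>\<^sub>F n in sequentially. nat \<lceil>4 * B / m\<rceil> \<le> n" by (rule eventually_ge_at_top)
    then show ?case
    proof eventually_elim
      case (elim n)
      then have "4 * B / m \<le> real n" by linarith
      then have "4 * B \<le> real n * m" using m' by (simp add: pos_divide_le_eq)
      then have "real n * m / 2 \<le> 3 / 4 * m * real n - B" by (simp add: algebra_simps)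
      then show ?case using S[of n] unfolding m_def[symmetric] by linarith
    qed
  qed
qed

text \<open>
  To the right the increments of the potential are read along the orbit of the shift. To the left they
  are read along the orbit of the inverse shift, starting one step away from the origin, at the edge
  \<open>{-1, 0}\<close>; stationarity gives the first of them the same mean.
\<close>

lemma potential_linear_growth:
  assumes "0 < \<epsilon>"
  shows "AE a in P. \<forall>\<^sub>F n in sequentially.
      real n * mean_resistance \<epsilon> / 2 \<le> potential (\<lambda>x. resistance \<epsilon> (shift x a)) (int n) \<and>
      potential (\<lambda>x. resistance \<epsilon> (shift x a)) (- int n) \<le> - (real n * mean_resistance \<epsilon> / 2)"
proof -
  note bd = bounded_resistance[OF assms]
  have pos: "0 < mean_resistance \<epsilon>"
  proof -
    have "0 \<le> mean_resistance \<epsilon>"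
      unfolding mean_resistance_def using resistance_pos[OF assms] by (simp add: less_imp_le)
    moreover have "mean_resistance \<epsilon> \<noteq> 0"
    proof
      assume "mean_resistance \<epsilon> = 0"
      then have "AE a in P. resistance \<epsilon> a = 0"
        unfolding mean_resistance_def
        using integral_nonneg_eq_0_iff_AE[OF bounded_rv_integrable[OF bd]]
          resistance_pos[OF assms] by (simp add: less_imp_le)
      then have "AE a in P. False"
        using resistance_pos[OF assms] by (auto simp: less_le)
      then show False by simp
    qed
    ultimately show ?thesis by simp
  qed
  have e: "(\<integral>a. resistance \<epsilon> (shift (-1) a) \<partial>P) = mean_resistance \<epsilon>"
    unfolding mean_resistance_def by (rule integral_shift) simp
  have sh: "shift (-1) (shift (int i * -1) a) = shift (- int i - 1) a" for i a
    unfolding shift_shift by (rule arg_cong[where f="\<lambda>y. shift y a"]) simp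
  have 1: "AE a in P. \<forall>\<^sub>F n in sequentially.
      real n * mean_resistance \<epsilon> / 2 \<le> (\<Sum>i<n. resistance \<epsilon> (shift (int i * 1) a))"
    using birkhoff_lower[OF _ bd, of 1] pos by (simp add: mean_resistance_def)
  have 2: "AE a in P. \<forall>\<^sub>F n in sequentially.
      real n * mean_resistance \<epsilon> / 2 \<le> (\<Sum>i<n. resistance \<epsilon> (shift (-1) (shift (int i * -1) a)))"
    using birkhoff_lower[OF _ bounded_rv_shift[OF bd], of "-1" "-1"] pos unfolding e by simp
  from 1 2 show ?thesis
  proof eventually_elim
    case (elim a)
    from elim show ?case
    proof eventually_elim
      case (elim n)
      then show ?case
        unfolding sh by (simp add: potential_of_nat potential_of_neg_nat)
    qed
  qed
qed

lemma mean_resistance_pos: "\<exists>\<epsilon>>0. 0 < mean_resistance \<epsilon>"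
  using mean_resistance_unbounded by blast

text \<open>
  The resistance dominates its cut-off version, for which the growth is already linear.
\<close>

lemma total_resistance_infinite:
  "AE a in P. filterlim (potential (\<lambda>x. 1 / enn2real (a x))) at_top at_top \<and>
              filterlim (potential (\<lambda>x. 1 / enn2real (a x))) at_bot at_bot"
proof -
  obtain \<epsilon> where \<epsilon>: "0 < \<epsilon>" "0 < mean_resistance \<epsilon>" using mean_resistance_pos by blast
  show ?thesis
    using potential_linear_growth[OF \<epsilon>(1)] positive finite_conductances
  proof eventually_elim
    case (elim a)
    have le: "resistance \<epsilon> (shift x a) \<le> 1 / enn2real (a x)" for x
    proof -
      have "0 < enn2real (a x)" using elim(2,3) by (simp add: enn2real_positive_iff)
      then show ?thesis by (simp add: resistance_def shift_def frac_le)
    qed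
    from elim(1) have "\<forall>\<^sub>F n in sequentially. real n * (mean_resistance \<epsilon> / 2)
        \<le> potential (\<lambda>x. 1 / enn2real (a x)) (int n) \<and>
        potential (\<lambda>x. 1 / enn2real (a x)) (- int n) \<le> - (real n * (mean_resistance \<epsilon> / 2))"
    proof eventually_elim
      case (elim n)
      have "potential (\<lambda>x. resistance \<epsilon> (shift x a)) (int n) \<le> potential (\<lambda>x. 1 / enn2real (a x)) (int n)"
        "potential (\<lambda>x. 1 / enn2real (a x)) (- int n) \<le> potential (\<lambda>x. resistance \<epsilon> (shift x a)) (- int n)"
        by (intro potential_comparison le)+
      with elim show ?case by (simp only: times_divide_eq_right) linarith
    qed
    then show ?case using filterlim_int_at_top_bot \<epsilon>(2) half_gt_zero by blast
  qed
qed

text \<open>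
  The potential is monotone, so its growth at the two points \<open>N\<close> and \<open>- N\<close> controls it at every point
  at distance at least \<open>N\<close> from the origin.
\<close>

definition high_resistance :: "real \<Rightarrow> nat \<Rightarrow> (int \<Rightarrow> ennreal) set" where
  "high_resistance \<epsilon> N = {a. real N * mean_resistance \<epsilon> / 2 \<le> potential (\<lambda>x. resistance \<epsilon> (shift x a)) (int N) \<and>
      potential (\<lambda>x. resistance \<epsilon> (shift x a)) (- int N) \<le> - (real N * mean_resistance \<epsilon> / 2)}"

lemma potential_measurable [measurable]:
  "(\<lambda>a. potential (\<lambda>x. resistance \<epsilon> (shift x a)) y) \<in> borel_measurable P"
  unfolding potential_def by measurable

lemma high_resistance_measurable [measurable]: "high_resistance \<epsilon> N \<in> sets P"
proof -
  have "high_resistance \<epsilon> N = {a \<in> space P. real N * mean_resistance \<epsilon> / 2 \<le> potential (\<lambda>x. resistance \<epsilon> (shift x a)) (int N) \<and>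
      potential (\<lambda>x. resistance \<epsilon> (shift x a)) (- int N) \<le> - (real N * mean_resistance \<epsilon> / 2)}"
    by (simp add: high_resistance_def)
  also have "\<dots> \<in> sets P" by measurable
  finally show ?thesis .
qed

lemma prob_not_high_resistance:
  assumes "0 < \<epsilon>"
  shows "(\<lambda>N. prob (- high_resistance \<epsilon> N)) \<longlonglongrightarrow> 0"
proof -
  have [measurable]: "- high_resistance \<epsilon> N \<in> sets P" for N
    using sets.compl_sets[OF high_resistance_measurable, of \<epsilon> N] by (simp add: Compl_eq_Diff_UNIV)
  have "(\<lambda>N. \<integral>a. indicator (- high_resistance \<epsilon> N) a \<partial>P) \<longlonglongrightarrow> (\<integral>a. (0::real) \<partial>P)"
  proof (rule integral_dominated_convergence[where w="\<lambda>_. 1"])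
    show "AE a in P. (\<lambda>N. indicator (- high_resistance \<epsilon> N) a) \<longlonglongrightarrow> (0::real)"
      using potential_linear_growth[OF assms]
    proof eventually_elim
      case (elim a)
      then have "\<forall>\<^sub>F N in sequentially. indicator (- high_resistance \<epsilon> N) a = (0::real)"
        by eventually_elim (simp add: high_resistance_def)
      then show ?case by (rule tendsto_eventually)
    qed
  qed (auto simp: indicator_def)
  then show ?thesis by simp
qed

text \<open>
  The truncation level \<open>c = n / (4 t)\<close> grows with \<open>n\<close>, so that each edge eventually keeps its own
  conductance, while \<open>h c = 1 / 4\<close> for the time step \<open>h = t / n\<close>, so that every walk is lazy.
\<close>

definition walk_tail :: "real \<Rightarrow> real \<Rightarrow> nat \<Rightarrow> (int \<Rightarrow> ennreal) \<Rightarrow> real" where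
  "walk_tail t R n a =
     (walk_step (t / real n) (\<lambda>x. min (enn2real (a x)) (real n / (4 * t))) ^^ n)
       (indicator {x. R \<le> \<bar>real_of_int x\<bar>}) 0"

lemma walk_tail_measurable [measurable]: "walk_tail t R n \<in> borel_measurable P"
proof -
  have "(\<lambda>a. (walk_step h (\<lambda>x. min (enn2real (a x)) c) ^^ k) f y) \<in> borel_measurable P" for h c k f y
  proof (induction k arbitrary: y)
    case (Suc k)
    note [measurable] = Suc
    show ?case by (simp add: walk_step_def[of h _ "(_ ^^ k) f"])
  qed simp
  then show ?thesis by (simp add: walk_tail_def[abs_def])
qed

text \<open>
  Chebyshev's inequality for the potential. On \<open>high_resistance\<close> a displacement of at least \<open>R\<close>, hence
  of at least \<open>N = \<lceil>R\<rceil>\<close>, makes the potential at least \<open>N m / 2\<close> in absolute value, and its second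
  moment at time \<open>t\<close> is at most \<open>2 t \<E> (b g\<^sup>2) \<le> 2 t m\<close>. The bound does not depend on \<open>n\<close>.
\<close>

lemma expectation_walk_tail:
  assumes t: "0 < t" and n: "0 < n" and \<epsilon>: "0 < \<epsilon>" and m: "0 < mean_resistance \<epsilon>"
    and R: "0 < R" "R \<le> real N" "real N < R + 1"
  shows "(\<integral>\<^sup>+a. ennreal (walk_tail t R n a) \<partial>P)
    \<le> ennreal (prob (- high_resistance \<epsilon> N) + 8 * t / (R\<^sup>2 * mean_resistance \<epsilon>))"
proof -
  define h where "h = t / real n"
  define c where "c = real n / (4 * t)"
  define b where "b = (\<lambda>a::int \<Rightarrow> ennreal. min (enn2real (a 0)) c)"
  define g where "g = resistance \<epsilon>"
  define \<psi> where "\<psi> = (\<lambda>a. potential (\<lambda>x. g (shift x a)))"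
  define r where "r = real N * mean_resistance \<epsilon> / 2"
  have hc: "0 \<le> h" "h * c = 1 / 4" "real n * h = t" "0 \<le> c" using t n by (auto simp: h_def c_def)
  have g: "bounded_rv g" unfolding g_def by (rule bounded_resistance[OF \<epsilon>])
  interpret stationary_walk_gradient P b c h g
  proof
    show "b \<in> borel_measurable P" unfolding b_def by measurable
  qed (use hc g in \<open>auto simp: b_def\<close>)
  have beta: "(\<lambda>x. min (enn2real (a x)) c) = (\<lambda>x. b (shift x a))" for a
    by (simp add: b_def shift_def)
  have lazy: "lazy_walk h (\<lambda>x. b (shift x a))" for a
  proof
    fix x
    have "h * b (shift y a) \<le> h * c" for y using hc b_le by (intro mult_left_mono) auto
    from add_mono[OF this[of x] this[of "x - 1"]]
    show "h * (b (shift x a) + b (shift (x - 1) a)) \<le> 1" using hc by (simp add: distrib_left)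
  qed (use hc b_nonneg in auto)
  have rpos: "0 < r" using R m by (simp add: r_def)
  have ind: "indicator {x. R \<le> \<bar>real_of_int x\<bar>} y \<le> (1 / r\<^sup>2) * (\<psi> a y)\<^sup>2 + indicator (- high_resistance \<epsilon> N) a" for a y
  proof (cases "R \<le> \<bar>real_of_int y\<bar> \<and> a \<in> high_resistance \<epsilon> N")
    case True
    then have "int N \<le> y \<or> y \<le> - int N" using R by linarith
    moreover have "\<psi> a x \<le> \<psi> a y" if "x \<le> y" for x y
      unfolding \<psi>_def g_def using that resistance_pos[OF \<epsilon>] by (intro potential_mono) (auto simp: less_imp_le)
    moreover have "r \<le> \<psi> a (int N)" "\<psi> a (- int N) \<le> - r"
      using True by (auto simp: high_resistance_def r_def \<psi>_def g_def)
    ultimately have "r \<le> \<bar>\<psi> a y\<bar>" by (smt (verit))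
    then have "r\<^sup>2 \<le> (\<psi> a y)\<^sup>2" using rpos by (metis abs_le_square_iff abs_of_pos)
    then show ?thesis using rpos True by (simp add: pos_le_divide_eq)
  qed (auto simp: indicator_def)
  have pt: "walk_tail t R n a \<le> (1 / r\<^sup>2) * msq n a + indicator (- high_resistance \<epsilon> N) a" for a
  proof -
    have "walk_tail t R n a \<le> (walk_step h (\<lambda>x. b (shift x a)) ^^ n)
        (\<lambda>y. (1 / r\<^sup>2) * (\<psi> a y)\<^sup>2 + indicator (- high_resistance \<epsilon> N) a) 0"
      unfolding walk_tail_def h_def[symmetric] c_def[symmetric] beta
      by (rule lazy_walk.funpow_mono[OF lazy ind])
    also have "\<dots> = (1 / r\<^sup>2) * (walk_step h (\<lambda>x. b (shift x a)) ^^ n) (\<lambda>y. (\<psi> a y)\<^sup>2) 0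
        + indicator (- high_resistance \<epsilon> N) a"
      by (rule lazy_walk.funpow_affine[OF lazy])
    finally show ?thesis by (simp add: \<psi>_def potential_walk_moments)
  qed
  have tail_nonneg: "0 \<le> walk_tail t R n a" for a
  proof -
    have "(walk_step h (\<lambda>x. b (shift x a)) ^^ n) (\<lambda>y. 0 * 0 + 0) 0 \<le> walk_tail t R n a"
      unfolding walk_tail_def h_def[symmetric] c_def[symmetric] beta
      by (rule lazy_walk.funpow_mono[OF lazy]) simp
    then show ?thesis unfolding lazy_walk.funpow_affine[OF lazy] by simp
  qed
  have [measurable]: "- high_resistance \<epsilon> N \<in> sets P"
    using sets.compl_sets[OF high_resistance_measurable, of \<epsilon> N] by (simp add: Compl_eq_Diff_UNIV)
  have intm: "integrable P (msq n)" by (rule bounded_rv_integrable[OF bounded_msq])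
  have inti: "integrable P (indicator (- high_resistance \<epsilon> N) :: _ \<Rightarrow> real)"
    by (rule integrable_const_bound[where B=1]) auto
  have bg: "(\<integral>a. b a * (g a)\<^sup>2 \<partial>P) \<le> mean_resistance \<epsilon>"
    unfolding mean_resistance_def g_def[symmetric]
  proof (rule integral_mono)
    fix a
    have "b a * g a \<le> 1"
      using \<epsilon> by (simp add: b_def g_def resistance_def pos_divide_le_eq)
    then have "b a * g a * g a \<le> 1 * g a"
      using resistance_pos[OF \<epsilon>, of a] by (intro mult_right_mono) (auto simp: g_def)
    then show "b a * (g a)\<^sup>2 \<le> g a" by (simp add: power2_eq_square mult.assoc)
  qed (use g in \<open>auto intro!: bounded_rv_integrable bounded_rv_mult bounded_rv_power\<close>)
  have "(\<integral>\<^sup>+a. ennreal (walk_tail t R n a) \<partial>P)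
      \<le> (\<integral>\<^sup>+a. ennreal ((1 / r\<^sup>2) * msq n a + indicator (- high_resistance \<epsilon> N) a) \<partial>P)"
    by (intro nn_integral_mono ennreal_leI pt)
  also have "\<dots> = ennreal (\<integral>a. (1 / r\<^sup>2) * msq n a + indicator (- high_resistance \<epsilon> N) a \<partial>P)"
  proof (rule nn_integral_eq_integral)
    show "integrable P (\<lambda>a. (1 / r\<^sup>2) * msq n a + indicator (- high_resistance \<epsilon> N) a)"
      by (intro Bochner_Integration.integrable_add integrable_mult_right intm inti)
    show "AE a in P. 0 \<le> (1 / r\<^sup>2) * msq n a + indicator (- high_resistance \<epsilon> N) a"
      by (intro AE_I2 order_trans[OF tail_nonneg pt])
  qed
  also have "(\<integral>a. (1 / r\<^sup>2) * msq n a + indicator (- high_resistance \<epsilon> N) a \<partial>P)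
      = (1 / r\<^sup>2) * (\<integral>a. msq n a \<partial>P) + prob (- high_resistance \<epsilon> N)"
    using intm inti by simp
  also have "ennreal \<dots> \<le> ennreal (prob (- high_resistance \<epsilon> N) + 8 * t / (R\<^sup>2 * mean_resistance \<epsilon>))"
  proof (rule ennreal_leI)
    have "(\<integral>a. msq n a \<partial>P) \<le> 2 * real n * h * (\<integral>a. b a * (g a)\<^sup>2 \<partial>P)"
      by (rule expectation_msq_le)
    also have "\<dots> = 2 * t * (\<integral>a. b a * (g a)\<^sup>2 \<partial>P)" using hc(3) by simp
    also have "\<dots> \<le> 2 * t * mean_resistance \<epsilon>" using t bg by (intro mult_left_mono) auto
    finally have "(1 / r\<^sup>2) * (\<integral>a. msq n a \<partial>P) \<le> 2 * t * mean_resistance \<epsilon> / r\<^sup>2"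
      using rpos by (simp add: divide_right_mono)
    also have "\<dots> = 8 * t / ((real N)\<^sup>2 * mean_resistance \<epsilon>)"
      using m R by (simp add: r_def power2_eq_square field_simps)
    also have "\<dots> \<le> 8 * t / (R\<^sup>2 * mean_resistance \<epsilon>)"
      using m R t by (intro divide_left_mono mult_right_mono power_mono mult_pos_pos) auto
    finally show "(1 / r\<^sup>2) * (\<integral>a. msq n a \<partial>P) + prob (- high_resistance \<epsilon> N)
        \<le> prob (- high_resistance \<epsilon> N) + 8 * t / (R\<^sup>2 * mean_resistance \<epsilon>)" by simp
  qed
  finally show ?thesis .
qed

text \<open>
  The tail of the chain need not depend measurably on the environment, and integrals of nonmeasurable
  functions are monotone but not subadditive. For finitely many times the tails are therefore replaced
  by these measurable upper bounds before they are added.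
\<close>

definition tail_majorant :: "real \<Rightarrow> real \<Rightarrow> (int \<Rightarrow> ennreal) \<Rightarrow> ennreal" where
  "tail_majorant t R a = liminf (\<lambda>n. ennreal (walk_tail t R n a))"

lemma tail_majorant_measurable [measurable]: "tail_majorant t R \<in> borel_measurable P"
  unfolding tail_majorant_def[abs_def] by measurable

lemma tail_majorant_tendsto_0:
  assumes \<delta>: "0 < \<delta>"
  shows "((\<lambda>t. \<integral>\<^sup>+a. tail_majorant t (\<delta> * sqrt t) a \<partial>P) \<longlongrightarrow> 0) at_top"
  unfolding order_tendsto_iff
proof (intro conjI allI impI)
  fix z :: ennreal assume "z < 0"
  then show "\<forall>\<^sub>F t in at_top. z < (\<integral>\<^sup>+a. tail_majorant t (\<delta> * sqrt t) a \<partial>P)" by simp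
next
  fix z :: ennreal assume "0 < z"
  then obtain \<eta> where \<eta>: "0 < \<eta>" "ennreal \<eta> < z"
    by (metis dense ennreal_less_zero_iff ennreal_cases less_top_ennreal not_less_iff_gr_or_eq top.extremum_strict)
  \<comment> \<open>This mean resistance makes \<open>8 / (\<delta>\<^sup>2 m)\<close>, which is the Chebyshev bound, less than \<open>\<eta> / 2\<close>.\<close>
  obtain \<epsilon> where \<epsilon>: "0 < \<epsilon>" "max 0 (16 / (\<delta>\<^sup>2 * \<eta>)) < mean_resistance \<epsilon>"
    using mean_resistance_unbounded by blast
  then have m: "0 < mean_resistance \<epsilon>" "16 / (\<delta>\<^sup>2 * \<eta>) < mean_resistance \<epsilon>" by auto
  then have m8: "8 / (\<delta>\<^sup>2 * mean_resistance \<epsilon>) < \<eta> / 2"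
    using \<delta> \<eta>(1) by (simp add: field_simps)
  have "\<forall>\<^sub>F N in sequentially. prob (- high_resistance \<epsilon> N) < \<eta> / 2"
    using prob_not_high_resistance[OF \<epsilon>(1)] \<eta>(1) by (intro order_tendstoD) auto
  then obtain N0 where N0: "\<And>N. N0 \<le> N \<Longrightarrow> prob (- high_resistance \<epsilon> N) < \<eta> / 2"
    by (auto simp: eventually_sequentially)
  have "\<forall>\<^sub>F t in at_top. (real N0 / \<delta>)\<^sup>2 < t" by (rule eventually_gt_at_top)
  then show "\<forall>\<^sub>F t in at_top. (\<integral>\<^sup>+a. tail_majorant t (\<delta> * sqrt t) a \<partial>P) < z"
  proof eventually_elim
    case (elim t)
    then have t: "0 < t" using zero_le_power2[of "real N0 / \<delta>"] by linarith
    define R where "R = \<delta> * sqrt t"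
    define N where "N = nat \<lceil>R\<rceil>"
    have R: "0 < R" "R\<^sup>2 = \<delta>\<^sup>2 * t" using \<delta> t by (auto simp: R_def power_mult_distrib)
    have N: "R \<le> real N" "real N < R + 1" using R(1) unfolding N_def by linarith+
    have "real N0 / \<delta> < sqrt t" using elim by (simp add: real_less_rsqrt)
    then have "real N0 < R" using \<delta> by (simp add: R_def pos_divide_less_eq mult.commute)
    then have "N0 \<le> N" using N by linarith
    then have bd: "prob (- high_resistance \<epsilon> N) + 8 * t / (R\<^sup>2 * mean_resistance \<epsilon>) \<le> \<eta>"
      using N0[of N] m8 t by (simp add: R(2))
    have "(\<integral>\<^sup>+a. tail_majorant t R a \<partial>P) \<le> liminf (\<lambda>n. \<integral>\<^sup>+a. ennreal (walk_tail t R n a) \<partial>P)"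
      unfolding tail_majorant_def by (rule nn_integral_liminf) simp
    also have "\<dots> \<le> liminf (\<lambda>n. ennreal \<eta>)"
    proof (rule Liminf_mono)
      show "\<forall>\<^sub>F n in sequentially. (\<integral>\<^sup>+a. ennreal (walk_tail t R n a) \<partial>P) \<le> ennreal \<eta>"
        using eventually_gt_at_top[of 0]
      proof eventually_elim
        case (elim n)
        show ?case
          by (rule order_trans[OF expectation_walk_tail[OF t elim \<epsilon>(1) m(1) R(1) N]]) (rule ennreal_leI[OF bd])
      qed
    qed
    also have "\<dots> = ennreal \<eta>" by (simp add: Liminf_const)
    finally show ?case using \<eta>(2) unfolding R_def by (rule le_less_trans)
  qed
qed

lemma AE_conductance_chain:
  assumes "AE a in P. ctmc (gen a) (Q a) X"
  shows "AE a in P. conductance_chain a (Q a) X"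
  using assms positive finite_conductances by eventually_elim (simp add: conductance_chain_def)

lemma tail_le_majorant:
  assumes "AE a in P. ctmc (gen a) (Q a) X"
  shows "AE a in P. \<forall>t>0. \<forall>R. emeasure (Q a 0) {w \<in> space (Q a 0). R \<le> \<bar>real_of_int (X t w)\<bar>}
    \<le> tail_majorant t R a"
  using AE_conductance_chain[OF assms] total_resistance_infinite
  by eventually_elim (auto simp: tail_majorant_def walk_tail_def intro!: conductance_chain.tail_le_liminf)

theorem averaged_tail_tendsto_0:
  assumes "AE a in P. ctmc (gen a) (Q a) X" and "0 < \<delta>"
  shows "((\<lambda>t. averaged_prob P Q (\<lambda>w. \<bar>real_of_int (X t w)\<bar> \<ge> \<delta> * sqrt t)) \<longlongrightarrow> 0) at_top"
proof (rule tendsto_sandwich[OF _ _ tendsto_const tail_majorant_tendsto_0[OF assms(2)]])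
  show "\<forall>\<^sub>F t in at_top. averaged_prob P Q (\<lambda>w. \<bar>real_of_int (X t w)\<bar> \<ge> \<delta> * sqrt t)
      \<le> (\<integral>\<^sup>+a. tail_majorant t (\<delta> * sqrt t) a \<partial>P)"
    using eventually_gt_at_top[of 0]
  proof eventually_elim
    case (elim t)
    have "AE a in P. emeasure (Q a 0) {w \<in> space (Q a 0). \<delta> * sqrt t \<le> \<bar>real_of_int (X t w)\<bar>}
        \<le> tail_majorant t (\<delta> * sqrt t) a"
      using tail_le_majorant[OF assms(1)] by eventually_elim (use elim in blast)
    then show ?case unfolding averaged_prob_def by (rule nn_integral_mono_AE)
  qed
qed simp

text \<open>
  If the Euclidean norm exceeds \<open>\<epsilon>\<close>, then one of the \<open>k\<close> coordinates exceeds \<open>\<epsilon> / k\<close>, and this is the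
  tail event at time \<open>n t\<^sub>i\<close> with \<open>\<delta> = \<epsilon> / (k \<surd>t\<^sub>i)\<close>. Times \<open>t\<^sub>i = 0\<close> contribute nothing because
  the chain starts at the origin.
\<close>

theorem averaged_fdd_tendsto_0:
  fixes k :: nat and t :: "nat \<Rightarrow> real"
  assumes ctmc: "AE a in P. ctmc (gen a) (Q a) X"
    and t: "\<And>i. i < k \<Longrightarrow> 0 \<le> t i" and k: "1 \<le> k" and \<epsilon>: "0 < \<epsilon>"
  shows "(\<lambda>n. averaged_prob P Q
      (\<lambda>w. L2_set (\<lambda>i. real_of_int (X (real n * t i) w) / sqrt (real n)) {..<k} > \<epsilon>)) \<longlonglongrightarrow> 0"
proof -
  define I where "I = {i. i < k \<and> 0 < t i}"
  have I: "finite I" by (simp add: I_def)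
  define M where "M = (\<lambda>i s. tail_majorant s (\<epsilon> / (real k * sqrt (t i)) * sqrt s))"
  have lim: "(\<lambda>n. \<Sum>i\<in>I. \<integral>\<^sup>+a. M i (real n * t i) a \<partial>P) \<longlonglongrightarrow> (\<Sum>i\<in>I. 0)"
  proof (rule tendsto_sum)
    fix i assume i: "i \<in> I"
    have "((\<lambda>s. \<integral>\<^sup>+a. M i s a \<partial>P) \<longlongrightarrow> 0) at_top"
      unfolding M_def using i k \<epsilon> by (intro tail_majorant_tendsto_0) (simp add: I_def)
    moreover have "filterlim (\<lambda>n. real n * t i) at_top sequentially"
      using i by (intro filterlim_at_top_mult_tendsto_pos[OF tendsto_const] filterlim_real_sequentially) (simp add: I_def)
    ultimately show "(\<lambda>n. \<integral>\<^sup>+a. M i (real n * t i) a \<partial>P) \<longlonglongrightarrow> 0"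
      by (rule filterlim_compose)
  qed
  have le: "averaged_prob P Q
      (\<lambda>w. L2_set (\<lambda>i. real_of_int (X (real n * t i) w) / sqrt (real n)) {..<k} > \<epsilon>)
    \<le> (\<Sum>i\<in>I. \<integral>\<^sup>+a. M i (real n * t i) a \<partial>P)" if n: "0 < n" for n :: nat
  proof -
    have "AE a in P. emeasure (Q a 0) {w \<in> space (Q a 0).
        L2_set (\<lambda>i. real_of_int (X (real n * t i) w) / sqrt (real n)) {..<k} > \<epsilon>}
      \<le> (\<Sum>i\<in>I. M i (real n * t i) a)"
      using AE_conductance_chain[OF ctmc] tail_le_majorant[OF ctmc]
    proof eventually_elim
      case (elim a)
      interpret conductance_chain a "Q a" X by (rule elim)
      define \<rho> where "\<rho> = \<epsilon> / real k * sqrt (real n)"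
      have \<rho>: "0 < \<rho>" using \<epsilon> k n by (simp add: \<rho>_def)
      define E where "E = (\<lambda>i. {w \<in> space (Q a 0). \<rho> \<le> \<bar>real_of_int (X (real n * t i) w)\<bar>})"
      have E: "E i \<in> sets (Q a 0)" if "i < k" for i
      proof -
        have [measurable]: "X (real n * t i) \<in> measurable (Q a 0) (count_space UNIV)"
          using t[OF that] by (intro X_measurable) simp
        show ?thesis unfolding E_def by measurable
      qed
      have "{w \<in> space (Q a 0). L2_set (\<lambda>i. real_of_int (X (real n * t i) w) / sqrt (real n)) {..<k} > \<epsilon>}
          \<subseteq> (\<Union>i<k. E i)"
      proof
        fix w assume w: "w \<in> {w \<in> space (Q a 0).
          L2_set (\<lambda>i. real_of_int (X (real n * t i) w) / sqrt (real n)) {..<k} > \<epsilon>}"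
        show "w \<in> (\<Union>i<k. E i)"
        proof (rule ccontr)
          assume "w \<notin> (\<Union>i<k. E i)"
          then have small: "\<bar>real_of_int (X (real n * t i) w)\<bar> \<le> \<rho>" if "i < k" for i
            using w that by (auto simp: E_def not_le less_imp_le)
          have "L2_set (\<lambda>i. real_of_int (X (real n * t i) w) / sqrt (real n)) {..<k}
              \<le> (\<Sum>i<k. \<bar>real_of_int (X (real n * t i) w) / sqrt (real n)\<bar>)"
            by (rule L2_set_le_sum_abs)
          also have "\<dots> \<le> (\<Sum>i<k. \<epsilon> / real k)"
            using small n by (intro sum_mono) (auto simp: \<rho>_def abs_divide pos_divide_le_eq)
          also have "\<dots> = \<epsilon>" using k by simp
          finally show False using w by simp
        qed
      qed
      then have "emeasure (Q a 0) {w \<in> space (Q a 0).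
          L2_set (\<lambda>i. real_of_int (X (real n * t i) w) / sqrt (real n)) {..<k} > \<epsilon>}
          \<le> emeasure (Q a 0) (\<Union>i<k. E i)"
        using E by (intro emeasure_mono) auto
      also have "\<dots> \<le> (\<Sum>i<k. emeasure (Q a 0) (E i))"
        using E by (intro emeasure_subadditive_finite) auto
      also have "\<dots> = (\<Sum>i\<in>I. emeasure (Q a 0) (E i))"
      proof (rule sum.mono_neutral_right)
        show "\<forall>i\<in>{..<k} - I. emeasure (Q a 0) (E i) = 0"
        proof
          fix i assume i: "i \<in> {..<k} - I"
          then have "t i = 0" "i < k" using t[of i] by (auto simp: I_def)
          have "AE w in Q a 0. w \<notin> E i"
            using start[of 0] by eventually_elim (use \<rho> \<open>t i = 0\<close> in \<open>simp add: E_def\<close>)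
          then show "emeasure (Q a 0) (E i) = 0"
            using E[OF \<open>i < k\<close>] AE_iff_measurable[OF E[OF \<open>i < k\<close>], of "\<lambda>w. w \<notin> E i"] sets.sets_into_space
            by (auto simp: E_def)
        qed
      qed (auto simp: I_def)
      also have "\<dots> \<le> (\<Sum>i\<in>I. M i (real n * t i) a)"
      proof (rule sum_mono)
        fix i assume i: "i \<in> I"
        then have "\<epsilon> / (real k * sqrt (t i)) * sqrt (real n * t i) = \<rho>"
          by (simp add: \<rho>_def I_def real_sqrt_mult)
        moreover have "0 < real n * t i" using i n by (simp add: I_def)
        ultimately show "emeasure (Q a 0) (E i) \<le> M i (real n * t i) a"
          using elim(2) by (simp add: M_def E_def)
      qed
      finally show ?case .
    qed
    then have "averaged_prob P Q
        (\<lambda>w. L2_set (\<lambda>i. real_of_int (X (real n * t i) w) / sqrt (real n)) {..<k} > \<epsilon>)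
      \<le> (\<integral>\<^sup>+a. (\<Sum>i\<in>I. M i (real n * t i) a) \<partial>P)"
      unfolding averaged_prob_def by (rule nn_integral_mono_AE)
    also have "\<dots> = (\<Sum>i\<in>I. \<integral>\<^sup>+a. M i (real n * t i) a \<partial>P)"
      by (rule nn_integral_sum) (simp add: M_def)
    finally show ?thesis .
  qed
  show ?thesis
  proof (rule tendsto_sandwich[OF _ _ tendsto_const])
    show "(\<lambda>n. \<Sum>i\<in>I. \<integral>\<^sup>+a. M i (real n * t i) a \<partial>P) \<longlonglongrightarrow> 0" using lim by simp
    show "\<forall>\<^sub>F n in sequentially. averaged_prob P Q
        (\<lambda>w. L2_set (\<lambda>i. real_of_int (X (real n * t i) w) / sqrt (real n)) {..<k} > \<epsilon>)
      \<le> (\<Sum>i\<in>I. \<integral>\<^sup>+a. M i (real n * t i) a \<partial>P)"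
      using eventually_gt_at_top[of 0] by eventually_elim (rule le)
  qed simp
qed

end

section \<open>Subdiffusivity\<close>

theorem theorem2p1:
  fixes P :: "(int \<Rightarrow> ennreal) measure"
    and Q :: "(int \<Rightarrow> ennreal) \<Rightarrow> int \<Rightarrow> 'w measure"
    and X :: "real \<Rightarrow> 'w \<Rightarrow> int"
  assumes "prob_space P" and "sets P = sets env_space"
    and "AE a in P. \<forall>x. 0 < a x"
    and "stationary P" and "ergodic P"
    and "AE a in P. a 0 < \<infinity>"
    and "(\<integral>\<^sup>+a. inverse (a 0) \<partial>P) = \<infinity>"
    and "AE a in P. ctmc (gen a) (Q a) X"
  shows "(\<forall>\<delta>>0. ((\<lambda>t::real. averaged_prob P Q
                    (\<lambda>w. \<bar>real_of_int (X t w)\<bar> \<ge> \<delta> * sqrt t)) \<longlongrightarrow> 0) at_top) \<and>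
         (\<forall>k\<ge>1. \<forall>t::nat \<Rightarrow> real. (\<forall>i<k. 0 \<le> t i) \<longrightarrow>
            (\<forall>\<epsilon>>0. (\<lambda>n::nat. averaged_prob P Q
               (\<lambda>w. L2_set (\<lambda>i. real_of_int (X (real n * t i) w) / sqrt (real n)) {..<k} > \<epsilon>))
               \<longlonglongrightarrow> 0))"
proof -
  interpret prob_space P by (rule assms(1))
  interpret infinite_resistance_environment P
    by unfold_locales (use assms in auto)
  show ?thesis
    using averaged_tail_tendsto_0[OF assms(8)] averaged_fdd_tendsto_0[OF assms(8)] by blast
qed

end
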